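(* Let $\eta\neq0$ be a fixed complex number, let $a_0(z),\dots,a_n(z)$ be polynomials, not all identically zero, and let $f$ be a transcendental entire solution, of order $\sigma(f)=\chi<1$, of the difference equation $$a_n(z)\Delta^n f(z)+\cdots+a_1(z)\Delta f(z)+a_0(z)f(z)=0.$$ Then $\chi$ is a rational number which can be determined from a gradient of the Newton–Puiseux diagram of this equation (that is, $-\chi$ is the slope of one of the edges of the diagram). In particular, $\chi>0$ and there is a constant $L>0$ such that $$\log M(r,f)=L\,r^{\chi}\big(1+o(1)\big)\qquad (r\to\infty).$$ That is, the solution has completely regular growth.
   Context: The difference operator is $\Delta f(z)=f(z+\eta)-f(z)$, with $\Delta^k f=\Delta(\Delta^{k-1}f)$ for $k\ge 2$ and $\Delta^1=\Delta$. $M(r,f)=\max_{|z|=r}|f(z)|$, and the order is $\sigma(f)=\limsup_{r\to\infty}\frac{\log\log M(r,f)}{\log r}$. In this statement, "completely regular growth" means precisely the displayed asymptotic relation $\log M(r,f)=Lr^\chi(1+o(1))$ with $L>0$, $\chi>0$. The Newton–Puiseux diagram of the equation is the upper boundary of the convex hull of the points $(j,\ \deg a_j-j)$, over those $j\in\{0,\dots,n\}$ with $a_j\not\equiv0$; its gradients are the slopes of its edges. (Equivalently, $-\chi$ is a slope of the diagram if and only if the maximum over such $j$ of $\deg a_j-j+j\chi$ is attained for at least two values of $j$.) *)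

theory Defs
  imports
    "HOL-Complex_Analysis.Complex_Analysis"
    "HOL-Computational_Algebra.Polynomial"
    "HOL-Library.Landau_Symbols"
begin

definition fdiff :: "complex \<Rightarrow> (complex \<Rightarrow> complex) \<Rightarrow> complex \<Rightarrow> complex" where
  "fdiff \<eta> f = (\<lambda>z. f (z + \<eta>) - f z)"

text \<open>For continuous \<open>f\<close> and \<open>r \<ge> 0\<close> the supremum is attained, the circle being compact.\<close>

definition max_modulus :: "real \<Rightarrow> (complex \<Rightarrow> complex) \<Rightarrow> real" where
  "max_modulus r f = (SUP z\<in>sphere 0 r. norm (f z))"

definition growth_order :: "(complex \<Rightarrow> complex) \<Rightarrow> ereal" where
  "growth_order f = Limsup at_top (\<lambda>r::real. ereal (ln (ln (max_modulus r f)) / ln r))"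

definition transcendental_entire :: "(complex \<Rightarrow> complex) \<Rightarrow> bool" where
  "transcendental_entire f \<longleftrightarrow> f holomorphic_on UNIV \<and> \<not> (\<exists>p. \<forall>z. f z = poly p z)"

definition newton_puiseux_points :: "nat \<Rightarrow> (nat \<Rightarrow> complex poly) \<Rightarrow> (real \<times> real) set" where
  "newton_puiseux_points n a =
     {(real j, real (degree (a j)) - real j) | j. j \<le> n \<and> a j \<noteq> 0}"

definition newton_puiseux_diagram :: "nat \<Rightarrow> (nat \<Rightarrow> complex poly) \<Rightarrow> (real \<times> real) set" where
  "newton_puiseux_diagram n a =
     {(x, y) \<in> convex hull newton_puiseux_points n a.
        \<forall>y'. (x, y') \<in> convex hull newton_puiseux_points n a \<longrightarrow> y' \<le> y}"

text \<open>The edges of the diagram are the one-dimensional faces of the polygon that lie on its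
  upper boundary. If the polygon degenerates to a segment, that segment is its only edge; if it
  is a single point, there is none.\<close>

definition newton_puiseux_gradient :: "nat \<Rightarrow> (nat \<Rightarrow> complex poly) \<Rightarrow> real \<Rightarrow> bool" where
  "newton_puiseux_gradient n a m \<longleftrightarrow>
     (\<exists>p q. closed_segment p q edge_of (convex hull newton_puiseux_points n a) \<and>
            closed_segment p q \<subseteq> newton_puiseux_diagram n a \<and>
            fst p < fst q \<and> m = (snd q - snd p) / (fst q - fst p))"

end

theory Submission
  imports Defs "HOL-Real_Asymp.Real_Asymp"
begin

text \<open>
  The proof is a Wiman-Valiron argument built on the maximum modulus itself. By Hadamard's three
  circle theorem \<open>\<Phi> t = ln M (exp t)\<close> is convex. Let \<open>K\<close> be a subgradient of \<open>\<Phi>\<close>, that is, the slope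
  \<open>r M' / M\<close> at \<open>r = exp t\<close>. It is nondecreasing, it tends to infinity because \<open>f\<close> is not a
  polynomial, and \<open>K t / exp t\<close> tends to zero because the order is less than one.

  Call \<open>u\<close> steady if \<open>K\<close> is almost constant within \<open>1 / K u\<close> of \<open>u\<close>. Borel's growth argument finds a
  steady point in every interval of fixed length far enough to the right. At a steady \<open>u\<close> let \<open>z\<close>
  with \<open>norm z = exp u\<close> be a point where the maximum modulus is attained. On a disc about \<open>z\<close> of
  radius comparable to \<open>norm z / K u\<close>, convexity bounds \<open>f (z + w) / f z * exp (- K u * w / z)\<close> by
  \<open>1 + \<epsilon>\<close>, and the value at the centre is one; so this quotient is almost constant
  (\<open>wiman_valiron_local\<close>). Cauchy's estimates turn this into
  \<open>\<Delta>\<^sup>k f z / f z = (\<eta> * K u / z) ^ k * (1 + o(1))\<close> (\<open>wiman_valiron_differences\<close>).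

  Put into the difference equation, this says that the sum of the terms
  \<open>lead_coeff (a j) * \<eta> ^ j * z ^ (degree (a j) - j) * K u ^ j\<close> is small compared with their absolute
  values. Hence the two largest terms are comparable, which is Newton's polygon: up to a
  factor near one \<open>K u\<close> equals \<open>s * exp (\<sigma> * u)\<close>, where \<open>- \<sigma>\<close> is the slope of an edge and \<open>s\<close> the
  modulus of a nonzero root of a polynomial attached to this edge (\<open>near_cancellation\<close>). There are
  finitely many such pairs \<open>(s, \<sigma>)\<close>.

  So far this concerns steady points only, and the pair may vary with \<open>u\<close>. Monotonicity of \<open>K\<close>
  settles both: \<open>K\<close> cannot descend from one of these curves to a lower one, hence it changes the
  curve finitely often, and between steady points it is squeezed (\<open>mono_follows_one_curve\<close>). Thus
  \<open>K t\<close> is asymptotic to \<open>s * exp (\<sigma> * t)\<close>, with \<open>\<sigma> > 0\<close> since \<open>K\<close> is unbounded. Integration gives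
  \<open>\<Phi> t\<close> asymptotic to \<open>s / \<sigma> * exp (\<sigma> * t)\<close>; in particular \<open>\<sigma>\<close> is the order of \<open>f\<close>.
\<close>

section \<open>The maximum modulus as a convex function of the logarithmic radius\<close>

lemma continuous_on_norm_entire:
  assumes "f holomorphic_on UNIV"
  shows "continuous_on A (\<lambda>z. norm (f z :: complex))"
  using assms by (intro continuous_intros holomorphic_on_imp_continuous_on holomorphic_on_subset[OF assms]) auto

lemma norm_le_max_modulus:
  assumes "f holomorphic_on UNIV"
  shows "norm (f z) \<le> max_modulus (norm z) f"
proof -
  have "continuous_on (sphere 0 (norm z)) (\<lambda>z. norm (f z))"
    using assms(1) by (rule continuous_on_norm_entire)
  then have "compact ((\<lambda>z. norm (f z)) ` sphere 0 (norm z))"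
    using compact_continuous_image compact_sphere by blast
  then show ?thesis
    unfolding max_modulus_def by (intro cSUP_upper) (auto dest: compact_imp_bounded bounded_imp_bdd_above)
qed

lemma max_modulus_attained:
  assumes "f holomorphic_on UNIV" "r \<ge> 0"
  obtains z where "norm z = r" "norm (f z) = max_modulus r f"
proof -
  have "continuous_on (sphere 0 r) (\<lambda>z. norm (f z))"
    using assms(1) by (rule continuous_on_norm_entire)
  moreover have "sphere (0::complex) r \<noteq> {}"
    using assms(2) by simp
  ultimately obtain z where z: "z \<in> sphere 0 r" "\<And>w. w \<in> sphere 0 r \<Longrightarrow> norm (f w) \<le> norm (f z)"
    using continuous_attains_sup[OF compact_sphere] by metis
  then have "max_modulus r f = norm (f z)"
    unfolding max_modulus_def by (intro cSup_eq_maximum) auto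
  with z that show ?thesis by auto
qed

lemma max_modulus_pos:
  assumes f: "f holomorphic_on UNIV" and nz: "f z0 \<noteq> 0" and r: "r > 0"
  shows "max_modulus r f > 0"
proof (rule ccontr)
  assume "\<not> max_modulus r f > 0"
  then have zero: "f z = 0" if "norm z = r" for z
    using norm_le_max_modulus[OF f, of z] that by (simp add: not_less) (meson norm_le_zero_iff order_trans)
  have "f z0 = 0"
  proof (rule analytic_continuation[OF f open_UNIV connected_UNIV subset_UNIV UNIV_I _ _ UNIV_I])
    have mem: "complex_of_real r \<in> sphere 0 r" "- complex_of_real r \<in> sphere 0 r"
      using r by auto
    have "\<nexists>x. sphere 0 r = {x :: complex}"
    proof
      assume "\<exists>x. sphere 0 r = {x :: complex}"
      then have "complex_of_real r = - complex_of_real r"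
        using mem by (metis singletonD)
      with r show False by (simp add: complex_eq_iff)
    qed
    then show "complex_of_real r islimpt sphere 0 r"
      using mem by (intro connected_imp_perfect) (auto simp: connected_sphere)
  qed (use zero in auto)
  with nz show False by simp
qed

text \<open>Hadamard's three circle theorem, in the variable \<open>t = ln r\<close>. Pulled back along \<open>exp\<close> and
  multiplied by \<open>exp (- \<alpha> w)\<close>, where \<open>\<alpha>\<close> is the slope of the chord, \<open>f\<close> has the same bound on both
  edges of a vertical strip; the maximum principle applies although the strip is unbounded,
  because the modulus has period \<open>2 \<pi> i\<close>, so that its supremum is attained.\<close>

lemma convex_ln_max_modulus:
  assumes f: "f holomorphic_on UNIV" and nz: "f z0 \<noteq> 0"
  shows "convex_on UNIV (\<lambda>t. ln (max_modulus (exp t) f))"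
proof (rule convex_on_linorderI)
  fix \<theta> x y :: real
  assume \<theta>: "0 < \<theta>" "\<theta> < 1" and xy: "x < y"
  define \<Phi> where "\<Phi> = (\<lambda>t. ln (max_modulus (exp t) f))"
  have M: "max_modulus (exp t) f = exp (\<Phi> t)" for t
    using max_modulus_pos[OF f nz, of "exp t"] by (simp add: \<Phi>_def)
  define \<alpha> where "\<alpha> = (\<Phi> y - \<Phi> x) / (y - x)"
  define g where "g = (\<lambda>w. f (exp w) * exp (- of_real \<alpha> * w))"
  have g: "g holomorphic_on UNIV"
    unfolding g_def
    by (intro holomorphic_intros holomorphic_on_compose_gen[OF _ f, unfolded o_def]) auto
  have edge: "\<Phi> x - \<alpha> * x = \<Phi> y - \<alpha> * y"
    using xy by (simp add: \<alpha>_def field_simps)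
  have normg: "norm (g w) = norm (f (exp w)) * exp (- \<alpha> * Re w)" for w
    by (simp add: g_def norm_mult)
  have g_le: "norm (g w) \<le> exp (\<Phi> (Re w) - \<alpha> * Re w)" for w
    using norm_le_max_modulus[OF f, of "exp w"] M[of "Re w"]
    by (simp add: normg exp_diff exp_minus field_simps)
  define R where "R = cbox (Complex x 0) (Complex y (2*pi))"
  have R: "w \<in> R \<longleftrightarrow> x \<le> Re w \<and> Re w \<le> y \<and> 0 \<le> Im w \<and> Im w \<le> 2*pi" for w
    by (auto simp: R_def in_cbox_complex_iff)
  have "continuous_on R (\<lambda>w. norm (g w))"
    using g by (rule continuous_on_norm_entire)
  moreover have "Complex x 0 \<in> R"
    using xy by (simp add: R)
  ultimately obtain w0 where w0: "w0 \<in> R" "\<And>w. w \<in> R \<Longrightarrow> norm (g w) \<le> norm (g w0)"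
    using continuous_attains_sup[of R "\<lambda>w. norm (g w)"] by (auto simp: R_def)
  have strip: "norm (g w) \<le> norm (g w0)" if w: "x \<le> Re w" "Re w \<le> y" for w
  proof -
    define k where "k = \<lfloor>Im w / (2*pi)\<rfloor>"
    define w' where "w' = w - of_int k * (of_real (2*pi) * \<i>)"
    have "exp w' = exp w"
      unfolding w'_def exp_eq by (intro exI[of _ "- k"]) (simp add: algebra_simps)
    moreover have "Re w' = Re w" "Im w' = Im w - 2*pi*k"
      by (simp_all add: w'_def)
    moreover have "2*pi*k \<le> Im w" "Im w \<le> 2*pi*(k+1)"
      using floor_divide_lower[of "2*pi" "Im w"] floor_divide_upper[of "2*pi" "Im w"]
      by (simp_all add: k_def mult.commute)
    ultimately have "w' \<in> R" "norm (g w') = norm (g w)"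
      using w by (auto simp: R normg algebra_simps)
    then show ?thesis using w0(2)[of w'] by simp
  qed
  have "norm (g w0) \<le> exp (\<Phi> x - \<alpha> * x)"
  proof (cases "Re w0 = x \<or> Re w0 = y")
    case True
    then show ?thesis using g_le[of w0] edge by auto
  next
    case False
    define U where "U = {w. x < Re w \<and> Re w < y}"
    have "U = {w. Re w > x} \<inter> {w. Re w < y}"
      by (auto simp: U_def)
    then have "open U"
      by (simp add: open_Int open_halfspace_Re_gt open_halfspace_Re_lt)
    have "g constant_on UNIV"
      by (rule maximum_modulus_principle[OF g open_UNIV connected_UNIV \<open>open U\<close>, of w0])
         (use w0 False strip in \<open>auto simp: U_def R\<close>)
    then have "g w0 = g (of_real x)"
      by (metis UNIV_I constant_on_def)
    then show ?thesis using g_le[of "of_real x"] by simp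
  qed
  moreover define t where "t = (1 - \<theta>) * x + \<theta> * y"
  have tx: "x \<le> t" "t \<le> y"
    using mult_nonneg_nonneg[of \<theta> "y - x"] mult_nonneg_nonneg[of "1 - \<theta>" "y - x"] \<theta> xy
    by (simp_all add: t_def algebra_simps)
  obtain z where z: "norm z = exp t" "norm (f z) = exp (\<Phi> t)"
    using max_modulus_attained[OF f, of "exp t"] M by auto
  then have "z \<noteq> 0" by auto
  then have "Re (Ln z) = t" "exp (Ln z) = z"
    using z(1) by simp_all
  then have "exp (\<Phi> t - \<alpha> * t) \<le> norm (g w0)"
    using strip[of "Ln z"] tx z(2) by (simp add: normg exp_diff exp_minus field_simps)
  ultimately have "\<Phi> t - \<alpha> * t \<le> \<Phi> x - \<alpha> * x"
    using exp_le_cancel_iff order_trans by blast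
  then have "\<Phi> t \<le> \<Phi> x + \<alpha> * (\<theta> * (y - x))"
    by (simp add: t_def algebra_simps)
  also have "\<alpha> * (\<theta> * (y - x)) = \<theta> * (\<Phi> y - \<Phi> x)"
    using xy by (simp add: \<alpha>_def)
  finally show "ln (max_modulus (exp ((1 - \<theta>) *\<^sub>R x + \<theta> *\<^sub>R y)) f)
      \<le> (1 - \<theta>) * ln (max_modulus (exp x) f) + \<theta> * ln (max_modulus (exp y) f)"
    by (simp add: t_def \<Phi>_def algebra_simps)
qed auto

text \<open>The right derivative is a subgradient.\<close>

lemma convex_subgradient_exists:
  fixes \<Phi> :: "real \<Rightarrow> real"
  assumes "convex_on UNIV \<Phi>"
  shows "\<exists>K. \<forall>x y. K x * (y - x) \<le> \<Phi> y - \<Phi> x"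
proof (intro exI allI)
  fix x y
  show "Inf ((\<lambda>t. (\<Phi> x - \<Phi> t) / (x - t)) ` {x<..}) * (y - x) \<le> \<Phi> y - \<Phi> x"
    using convex_le_Inf_differential[OF assms, of x y] by simp
qed

lemma subgradient_mono:
  fixes \<Phi> :: "real \<Rightarrow> real"
  assumes "\<And>x y. K x * (y - x) \<le> \<Phi> y - \<Phi> x"
  shows "mono K"
proof
  fix x y :: real assume "x \<le> y"
  have "(K y - K x) * (y - x) \<ge> 0"
    using assms[of x y] assms[of y x] by (simp add: algebra_simps)
  then show "K x \<le> K y"
    using \<open>x \<le> y\<close> by (cases "x = y") (auto simp: zero_le_mult_iff)
qed

text \<open>If the slope stayed bounded, \<open>f\<close> would be dominated by a power of \<open>norm z\<close> and would be a
  polynomial by Liouville's theorem.\<close>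

lemma subgradient_at_top:
  assumes f: "transcendental_entire f"
    and sub: "\<And>x y. K x * (y - x) \<le> ln (max_modulus (exp y) f) - ln (max_modulus (exp x) f)"
  shows "filterlim K at_top at_top"
proof (rule ccontr)
  assume notop: "\<not> filterlim K at_top at_top"
  have hol: "f holomorphic_on UNIV" using f by (simp add: transcendental_entire_def)
  have "\<exists>z. f z \<noteq> 0"
    using f unfolding transcendental_entire_def by (metis poly_0)
  then obtain z0 where nz: "f z0 \<noteq> 0" ..
  have mono: "mono K" by (rule subgradient_mono[OF sub])
  obtain Z where "\<not> eventually (\<lambda>t. Z \<le> K t) at_top"
    using notop by (auto simp: filterlim_at_top)
  then have Z: "K t \<le> Z" for t
    using mono by (smt (verit) eventually_at_top_linorder monoD)
  define m where "m = nat \<lceil>Z\<rceil>"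
  have m: "Z \<le> real m" by (simp add: m_def) linarith
  define B where "B = max_modulus 1 f"
  have "norm (f z) \<le> B * norm z ^ m" if "1 \<le> norm z" for z
  proof -
    define t where "t = ln (norm z)"
    have t: "t \<ge> 0" "exp t = norm z" using that by (auto simp: t_def)
    have B: "B > 0" using max_modulus_pos[OF hol nz] by (simp add: B_def)
    have pos: "max_modulus (norm z) f > 0" using max_modulus_pos[OF hol nz, of "norm z"] that by linarith
    have "ln (max_modulus (norm z) f) \<le> ln B + K t * t"
      using sub[of t 0] t by (simp add: B_def)
    also have "K t * t \<le> real m * t"
      using Z[of t] m t by (intro mult_right_mono) auto
    finally have "max_modulus (norm z) f \<le> exp (ln B + real m * t)"
      using pos by (metis exp_le_cancel_iff exp_ln add_left_mono order_trans)
    also have "\<dots> = B * norm z ^ m"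
      using B t by (simp add: exp_add exp_of_nat_mult)
    finally show ?thesis using norm_le_max_modulus[OF hol, of z] by simp
  qed
  then have "f z = (\<Sum>k\<le>m. (deriv ^^ k) f 0 / fact k * z ^ k)" for z
    using Liouville_polynomial[OF hol, of 1 B m z] by blast
  then have "f z = poly (\<Sum>k\<le>m. monom ((deriv ^^ k) f 0 / fact k) k) z" for z
    by (simp add: poly_sum poly_monom)
  then show False using f by (auto simp: transcendental_entire_def)
qed

lemma potential_at_top:
  fixes \<Phi> :: "real \<Rightarrow> real"
  assumes sub: "\<And>x y. K x * (y - x) \<le> \<Phi> y - \<Phi> x" and K: "filterlim K at_top at_top"
  shows "filterlim \<Phi> at_top at_top"
proof -
  obtain s where s: "K s \<ge> 1"
    using K by (metis eventually_at_top_linorder filterlim_at_top order_refl)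
  have "filterlim (\<lambda>t. \<Phi> s + (t - s)) at_top at_top" by real_asymp
  moreover have "eventually (\<lambda>t. \<Phi> s + (t - s) \<le> \<Phi> t) at_top"
    using eventually_ge_at_top[of s]
  proof eventually_elim
    case (elim t)
    then have "1 * (t - s) \<le> K s * (t - s)" using s by (intro mult_right_mono) auto
    then show ?case using sub[of s t] by simp
  qed
  ultimately show ?thesis by (rule filterlim_at_top_mono)
qed

text \<open>The bound on the order is used through this limit: below order one, the step \<open>\<eta>\<close> is short compared
  with the distance \<open>r / K\<close> over which \<open>f\<close> changes by a constant factor.\<close>

lemma subgradient_small:
  assumes ord: "growth_order f < 1"
    and sub: "\<And>x y. K x * (y - x) \<le> ln (max_modulus (exp y) f) - ln (max_modulus (exp x) f)"
    and K: "filterlim K at_top at_top"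
  shows "((\<lambda>t. K t / exp t) \<longlongrightarrow> 0) at_top"
proof -
  define \<Phi> where "\<Phi> = (\<lambda>t. ln (max_modulus (exp t) f))"
  have sub': "K x * (y - x) \<le> \<Phi> y - \<Phi> x" for x y using sub by (simp add: \<Phi>_def)
  obtain c where c: "growth_order f < ereal c" "c < 1"
    using ord by (metis ereal_dense2 ereal_less(3) less_ereal.simps(1) one_ereal_def)
  have "eventually (\<lambda>r. ereal (ln (ln (max_modulus r f)) / ln r) < ereal c) at_top"
    using c(1) unfolding growth_order_def by (rule Limsup_lessD)
  then have "eventually (\<lambda>t. ln (\<Phi> t) / t < c) at_top"
    using eventually_compose_filterlim[OF _ exp_at_top] by (fastforce simp: \<Phi>_def)
  moreover have pos: "eventually (\<lambda>t. \<Phi> t > 0) at_top"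
    using potential_at_top[OF sub' K] by (auto simp: filterlim_at_top_dense)
  ultimately have "eventually (\<lambda>t. \<Phi> t < exp (c * t)) at_top"
    using eventually_gt_at_top[of 0]
  proof eventually_elim
    case (elim t)
    then have "ln (\<Phi> t) < c * t" by (simp add: field_simps)
    then show ?case using elim by (metis exp_less_cancel_iff exp_ln)
  qed
  then have "eventually (\<lambda>t. \<Phi> (t + 1) < exp (c * (t + 1))) at_top"
    by (rule eventually_compose_filterlim) real_asymp
  then have upper: "eventually (\<lambda>t. K t / exp t \<le> exp (c * (t + 1)) / exp t) at_top"
    using pos
  proof eventually_elim
    case (elim t)
    then show ?case using sub'[of t "t + 1"] by (intro divide_right_mono) auto
  qed
  have lower: "eventually (\<lambda>t. 0 \<le> K t / exp t) at_top"
    using K[unfolded filterlim_at_top, rule_format, of 0] by eventually_elim simp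
  have lim: "((\<lambda>t. exp (c * (t + 1)) / exp t) \<longlongrightarrow> 0) at_top"
  proof -
    define d where "d = 1 - c"
    have "d > 0" using c(2) by (simp add: d_def)
    then have "((\<lambda>t. exp (c - d * t)) \<longlongrightarrow> 0) at_top" by real_asymp
    then show ?thesis by (simp add: d_def exp_diff[symmetric] algebra_simps)
  qed
  show ?thesis
    by (rule tendsto_sandwich[OF lower upper tendsto_const lim])
qed

section \<open>Points where the slope is almost constant\<close>

text \<open>The window \<open>1 / K u\<close> is the increment of \<open>ln r\<close> over which the maximum modulus changes by about
  a factor \<open>exp 1\<close>; this is the scale on which \<open>f\<close> is compared with a monomial.\<close>

definition steady :: "(real \<Rightarrow> real) \<Rightarrow> real \<Rightarrow> real \<Rightarrow> bool" where
  "steady K \<delta> u \<longleftrightarrow> (\<forall>s. \<bar>s\<bar> \<le> 1 / K u \<longrightarrow> \<bar>K (u + s) - K u\<bar> \<le> \<delta> * K u)"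

text \<open>Borel's growth lemma. If every point of \<open>[t, t + h]\<close> were followed by a jump of \<open>K\<close> by the
  factor \<open>1 + \<delta>\<close> within distance \<open>3 / K\<close>, then iterating from \<open>t\<close> one would make steps bounded by a
  geometric series of sum at most \<open>h\<close>, while \<open>K\<close> grew without bound.\<close>

lemma growth_lemma:
  fixes K :: "real \<Rightarrow> real"
  assumes mono: "mono K" and \<delta>: "\<delta> > 0" and K: "K t > 0" "3 * (1 + \<delta>) / (\<delta> * K t) \<le> h"
  shows "\<exists>v\<in>{t..t + h}. K (v + 3 / K v) \<le> (1 + \<delta>) * K v"
proof (rule ccontr)
  assume "\<not> ?thesis"
  then have jump: "K (v + 3 / K v) > (1 + \<delta>) * K v" if "t \<le> v" "v \<le> t + h" for v
    using that by (force simp: not_le)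
  define q where "q = 1 / (1 + \<delta>)"
  have q: "0 < q" "q < 1" "1 - q = \<delta> * q" using \<delta> by (auto simp: q_def field_simps)
  define v where "v = (\<lambda>m. ((\<lambda>v. v + 3 / K v) ^^ m) t)"
  have v0: "v 0 = t" and vS: "v (Suc m) = v m + 3 / K (v m)" for m by (simp_all add: v_def)
  have geo: "3 / K t * (\<Sum>i<m. q ^ i) \<le> h" for m
  proof -
    have "(\<Sum>i<m. q ^ i) \<le> 1 / (1 - q)"
      using q by (simp add: sum_gp_strict divide_right_mono)
    then have "3 / K t * (\<Sum>i<m. q ^ i) \<le> 3 / K t * (1 / (1 - q))"
      using K by (intro mult_left_mono) auto
    also have "\<dots> = 3 * (1 + \<delta>) / (\<delta> * K t)" using q \<delta> by (simp add: q_def)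
    finally show ?thesis using K by simp
  qed
  have inv: "t \<le> v m \<and> v m \<le> t + 3 / K t * (\<Sum>i<m. q ^ i) \<and> K (v m) \<ge> K t / q ^ m" for m
  proof (induction m)
    case 0
    then show ?case by (simp add: v0)
  next
    case (Suc m)
    have pos: "K t / q ^ m > 0" using K q by simp
    have "3 / K (v m) \<le> 3 / (K t / q ^ m)"
      using Suc.IH pos by (intro frac_le) auto
    also have "\<dots> = 3 / K t * q ^ m" by simp
    finally have "3 / K (v m) \<le> 3 / K t * q ^ m" .
    then have "v (Suc m) \<le> t + 3 / K t * (\<Sum>i<Suc m. q ^ i)"
      using Suc by (simp add: vS algebra_simps)
    moreover have "t \<le> v (Suc m)"
      using Suc pos by (simp add: vS add_increasing2)
    moreover have "K (v (Suc m)) \<ge> K t / q ^ Suc m"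
    proof -
      have "K (v (Suc m)) \<ge> (1 + \<delta>) * K (v m)"
        unfolding vS using Suc geo[of m] by (intro less_imp_le[OF jump]) auto
      moreover have "(1 + \<delta>) * K (v m) \<ge> (1 + \<delta>) * (K t / q ^ m)"
        using Suc \<delta> by (intro mult_left_mono) auto
      ultimately show ?thesis using q by (simp add: q_def field_simps)
    qed
    ultimately show ?case by blast
  qed
  have "K t / q ^ m \<le> K (t + h)" for m
    using inv[of m] geo[of m] monoD[OF mono, of "v m" "t + h"] by linarith
  moreover obtain m where "K (t + h) / K t < (1 + \<delta>) ^ m"
    using real_arch_pow[of "1 + \<delta>"] \<delta> by auto
  then have "K (t + h) < K t / q ^ m"
    using K by (simp add: q_def field_simps)
  ultimately show False by (metis not_le)
qed

text \<open>The growth lemma controls \<open>K\<close> to the right of a point only. Taking three window lengths there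
  and moving to the middle of that stretch gives control on both sides.\<close>

lemma eventually_steady:
  fixes K :: "real \<Rightarrow> real"
  assumes mono: "mono K" and K: "filterlim K at_top at_top" and \<delta>: "\<delta> > 0" and h: "h > 0"
  shows "eventually (\<lambda>t. \<exists>u\<in>{t..t + h}. steady K \<delta> u) at_top"
proof -
  have "((\<lambda>t. 3 * (1 + \<delta>) / \<delta> / K t + 3 / K t) \<longlongrightarrow> 0 + 0) at_top"
    by (intro tendsto_add real_tendsto_divide_at_top[OF tendsto_const K])
  then have "((\<lambda>t. 3 * (1 + \<delta>) / (\<delta> * K t) + 3 / K t) \<longlongrightarrow> 0) at_top"
    by simp
  then have "eventually (\<lambda>t. 3 * (1 + \<delta>) / (\<delta> * K t) + 3 / K t < h) at_top"
    using h by (rule order_tendstoD)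
  moreover have "eventually (\<lambda>t. K t > 0) at_top"
    using K by (auto simp: filterlim_at_top_dense)
  ultimately show ?thesis
  proof eventually_elim
    case (elim t)
    then obtain v where v: "v \<in> {t..t + (h - 3 / K t)}" "K (v + 3 / K v) \<le> (1 + \<delta>) * K v"
      using growth_lemma[OF mono \<delta> \<open>K t > 0\<close>, of "h - 3 / K t"] by auto
    have Kv: "K v \<ge> K t" using v by (intro monoD[OF mono]) auto
    then have Kv0: "K v > 0" using elim by simp
    define u where "u = v + 3 / 2 * (1 / K v)"
    have u: "v \<le> u" using Kv0 by (simp add: u_def)
    have Ku: "K u \<ge> K v" by (rule monoD[OF mono u])
    have "3 / K v \<le> 3 / K t" using Kv elim by (intro divide_left_mono) auto
    moreover have "u \<le> v + 3 / K v" using Kv0 by (simp add: u_def field_simps)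
    ultimately have "u \<le> t + h" using v by auto
    have "steady K \<delta> u"
      unfolding steady_def
    proof (intro allI impI)
      fix s assume s: "\<bar>s\<bar> \<le> 1 / K u"
      have "1 / K u \<le> 1 / K v" using Ku Kv0 by (intro divide_left_mono) auto
      then have "v \<le> u + s" "u + s \<le> v + 3 / K v"
        using s u_def by (simp_all add: abs_le_iff)
      then have "K v \<le> K (u + s)" "K (u + s) \<le> (1 + \<delta>) * K v"
        using v(2) monoD[OF mono] order_trans by blast+
      moreover have "K u \<le> (1 + \<delta>) * K v"
        using v(2) monoD[OF mono \<open>u \<le> v + 3 / K v\<close>] by linarith
      moreover have "\<delta> * K v \<le> \<delta> * K u" using Ku \<delta> by simp
      ultimately show "\<bar>K (u + s) - K u\<bar> \<le> \<delta> * K u"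
        using Ku by (simp add: abs_le_iff algebra_simps)
    qed
    then show ?case using u v \<open>u \<le> t + h\<close> by (intro bexI[of _ u]) auto
  qed
qed

section \<open>Differences at points of maximum modulus\<close>

lemma fdiff_holomorphic:
  assumes "g holomorphic_on UNIV"
  shows "fdiff \<eta> g holomorphic_on UNIV"
  unfolding fdiff_def
  by (intro holomorphic_intros holomorphic_on_compose_gen[OF _ assms, unfolded o_def] assms) auto

lemma funpow_fdiff_add: "(fdiff \<eta> ^^ k) (\<lambda>w. g w + h w) = (\<lambda>w. (fdiff \<eta> ^^ k) g w + (fdiff \<eta> ^^ k) h w)"
  by (induction k) (auto simp: fdiff_def)

lemma funpow_fdiff_shift:
  "(fdiff \<eta> ^^ k) (\<lambda>w. c * g (z + w)) = (\<lambda>w. c * (fdiff \<eta> ^^ k) g (z + w))"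
  by (induction k) (auto simp: fdiff_def algebra_simps)

lemma funpow_fdiff_exp:
  "(fdiff \<eta> ^^ k) (\<lambda>w. exp (c * w)) = (\<lambda>w. (exp (c * \<eta>) - 1) ^ k * exp (c * w))"
  by (induction k) (auto simp: fdiff_def algebra_simps exp_add)

text \<open>Cauchy's estimate for the derivative on the disc of radius \<open>3 / 4 * R\<close>, which contains the
  segment from \<open>w\<close> to \<open>w + \<eta>\<close>.\<close>

lemma fdiff_bound:
  assumes g: "g holomorphic_on UNIV" and B: "\<And>w. norm w < R \<Longrightarrow> norm (g w) \<le> B"
    and R: "R > 0" and \<eta>: "norm \<eta> \<le> R / 4" and w: "norm w < R / 2"
  shows "norm (fdiff \<eta> g w) \<le> B * (4 * norm \<eta> / R)"
proof -
  have deriv: "norm (deriv g x) \<le> B * 4 / R" if x: "norm x < 3 / 4 * R" for x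
  proof -
    have "norm ((deriv ^^ 1) g x) \<le> fact 1 * B / (R / 4) ^ 1"
    proof (rule Cauchy_inequality)
      show "g holomorphic_on ball x (R / 4)" by (rule holomorphic_on_subset[OF g]) auto
      show "continuous_on (cball x (R / 4)) g"
        by (rule holomorphic_on_imp_continuous_on, rule holomorphic_on_subset[OF g]) auto
      show "norm (g y) \<le> B" if "norm (x - y) = R / 4" for y
        using norm_triangle_ineq4[of x "x - y"] that x by (intro B) auto
    qed (use R in auto)
    then show ?thesis by simp
  qed
  have "norm (g (w + \<eta>) - g w) \<le> B * 4 / R * norm (w + \<eta> - w)"
  proof (rule field_differentiable_bound[of "ball 0 (3 / 4 * R)" g "deriv g"])
    show "(g has_field_derivative deriv g x) (at x within ball 0 (3 / 4 * R))" for x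
      using g by (meson UNIV_I has_field_derivative_at_within holomorphic_derivI open_UNIV)
    show "w + \<eta> \<in> ball 0 (3 / 4 * R)"
      using norm_triangle_ineq[of w \<eta>] w \<eta> R by simp
  qed (use deriv w R in auto)
  then show ?thesis by (simp add: fdiff_def mult_ac)
qed

text \<open>Each difference costs half of the radius and gains a factor of order \<open>norm \<eta> / R\<close>. With \<open>R\<close>
  of order \<open>norm z / K u\<close>, the error stays small relative to \<open>(norm \<eta> * K u / norm z) ^ k\<close>, which is
  the size of \<open>\<Delta>\<^sup>k f z / f z\<close>.\<close>

lemma funpow_fdiff_bound:
  assumes "g holomorphic_on UNIV" "\<And>w. norm w < R \<Longrightarrow> norm (g w) \<le> B"
    and "R > 0" "B \<ge> 0" "norm \<eta> \<le> R / 2 ^ (k + 1)"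
  shows "norm ((fdiff \<eta> ^^ k) g 0) \<le> B * (2 ^ (k + 1) * norm \<eta> / R) ^ k"
  using assms
proof (induction k arbitrary: g R B)
  case 0
  then show ?case by simp
next
  case (Suc k)
  have "R / 2 ^ (Suc k + 1) \<le> R / 4"
    using Suc.prems(3) by (intro divide_left_mono) auto
  then have "norm \<eta> \<le> R / 4" using Suc.prems(5) by linarith
  then have "norm ((fdiff \<eta> ^^ k) (fdiff \<eta> g) 0)
      \<le> B * (4 * norm \<eta> / R) * (2 ^ (k + 1) * norm \<eta> / (R / 2)) ^ k"
    using Suc.prems by (intro Suc.IH fdiff_holomorphic fdiff_bound) auto
  also have "\<dots> \<le> B * (2 ^ (Suc k + 1) * norm \<eta> / R) * (2 ^ (k + 1) * norm \<eta> / (R / 2)) ^ k"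
    using Suc.prems by (intro mult_right_mono mult_left_mono divide_right_mono) auto
  also have "\<dots> = B * (2 ^ (Suc k + 1) * norm \<eta> / R) ^ Suc k"
    by (simp add: mult_ac)
  finally show ?case by (simp add: funpow_Suc_right del: funpow.simps)
qed

text \<open>A Borel-Caratheodory estimate, by Schwarz's lemma for \<open>(G - 1) / (2 \<epsilon> - (G - 1))\<close>. It matters
  that only an upper bound is assumed: zeros of \<open>G\<close> are excluded by the conclusion.\<close>

lemma norm_diff_one_le:
  assumes G: "G holomorphic_on ball 0 R" "G 0 = 1" and R: "R > 0" and \<epsilon>: "\<epsilon> > 0"
    and less: "\<And>w. norm w < R \<Longrightarrow> norm (G w) < 1 + \<epsilon>" and w: "norm w < R / 2"
  shows "norm (G w - 1) \<le> 2 * \<epsilon>"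
proof -
  (* e is the mirror image of 0 in the line Re = \<epsilon>, to the left of which G - 1 lies *)
  define e where "e = complex_of_real (2 * \<epsilon>)"
  have closer: "norm (G v - 1) < norm (e - (G v - 1))" if "norm v < R" for v
  proof -
    have "Re (G v - 1) < \<epsilon>"
      using less[OF that] complex_Re_le_cmod[of "G v"] by simp
    then have "0 < 4 * \<epsilon> * (\<epsilon> - Re (G v - 1))" using \<epsilon> by simp
    then have "(norm (G v - 1))\<^sup>2 < (norm (e - (G v - 1)))\<^sup>2"
      unfolding cmod_power2 by (simp add: e_def power2_eq_square algebra_simps)
    then show ?thesis by (rule power2_less_imp_less) simp
  qed
  define \<phi> where "\<phi> = (\<lambda>\<zeta>. (G (of_real R * \<zeta>) - 1) / (e - (G (of_real R * \<zeta>) - 1)))"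
  have scale: "norm (of_real R * \<zeta>) < R" if "norm \<zeta> < 1" for \<zeta> :: complex
    using that R by (simp add: norm_mult)
  have "norm (\<phi> (w / of_real R)) \<le> norm (w / of_real R)"
  proof (rule Schwarz_Lemma(1))
    have "(\<lambda>\<zeta>. G (of_real R * \<zeta>)) holomorphic_on ball 0 1"
      using scale by (intro holomorphic_on_compose_gen[OF _ G(1), unfolded o_def] holomorphic_intros) auto
    then show "\<phi> holomorphic_on ball 0 1"
      unfolding \<phi>_def using closer[OF scale] by (intro holomorphic_intros) force+
    show "norm (\<phi> \<zeta>) < 1" if "norm \<zeta> < 1" for \<zeta>
      using closer[OF scale[OF that]] by (simp add: \<phi>_def norm_divide divide_less_eq_1)
  qed (use w R G(2) in \<open>auto simp: \<phi>_def norm_divide\<close>)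
  also have "\<dots> \<le> 1 / 2" using w R by (simp add: norm_divide)
  finally have "norm (G w - 1) \<le> 1 / 2 * norm (e - (G w - 1))"
    using le_less_trans[OF norm_ge_zero closer[of w]] w R by (simp add: \<phi>_def norm_divide pos_divide_le_eq)
  also have "norm (e - (G w - 1)) \<le> 2 * \<epsilon> + norm (G w - 1)"
    using norm_triangle_ineq4[of e "G w - 1"] \<epsilon> by (simp add: e_def)
  finally show ?thesis by simp
qed

text \<open>Passing from \<open>z\<close> to \<open>z + w\<close> moves \<open>ln r\<close> by \<open>ln (norm (1 + w / z))\<close>, which agrees with
  \<open>Re (w / z)\<close> to first order.\<close>

lemma ln_norm_one_plus:
  fixes \<omega> :: complex
  assumes "norm \<omega> \<le> 1 / 2"
  shows "\<bar>ln (norm (1 + \<omega>))\<bar> \<le> 2 * norm \<omega>" "ln (norm (1 + \<omega>)) \<le> Re \<omega> + (norm \<omega>)\<^sup>2 / 2"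
    "norm (1 + \<omega>) > 0"
proof -
  define x where "x = norm (1 + \<omega>)"
  have x: "x \<le> 1 + norm \<omega>" "1 - norm \<omega> \<le> x"
    using norm_triangle_ineq[of 1 \<omega>] norm_triangle_ineq2[of 1 "- \<omega>"] by (auto simp: x_def)
  then have x0: "x > 0" using assms by simp
  then show "norm (1 + \<omega>) > 0" by (simp add: x_def)
  have "ln x \<le> norm \<omega>" using ln_le_minus_one[OF x0] x by simp
  moreover have "- 2 * norm \<omega> \<le> ln (1 - norm \<omega>)"
  proof -
    have "2 * (norm \<omega>)\<^sup>2 \<le> norm \<omega>"
      using assms mult_right_mono[of "2 * norm \<omega>" 1 "norm \<omega>"] by (simp add: power2_eq_square)
    then show ?thesis using ln_one_minus_pos_lower_bound[of "norm \<omega>"] assms by simp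
  qed
  moreover have "ln (1 - norm \<omega>) \<le> ln x" using x x0 assms by simp
  ultimately show "\<bar>ln (norm (1 + \<omega>))\<bar> \<le> 2 * norm \<omega>"
    using norm_ge_zero[of \<omega>] unfolding x_def[symmetric] by linarith
  have "2 * ln x = ln (x\<^sup>2)" using x0 by (simp add: ln_realpow)
  also have "\<dots> \<le> x\<^sup>2 - 1" using x0 by (intro ln_le_minus_one) simp
  also have "\<dots> = 2 * Re \<omega> + (norm \<omega>)\<^sup>2"
    unfolding x_def cmod_power2 by (simp add: power2_eq_square algebra_simps)
  finally show "ln (norm (1 + \<omega>)) \<le> Re \<omega> + (norm \<omega>)\<^sup>2 / 2" by (simp add: x_def)
qed

text \<open>The Wiman-Valiron estimate. At a point \<open>z\<close> of maximum modulus, \<open>f\<close> behaves like the monomial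
  of degree \<open>K u\<close>: convexity bounds \<open>f (z + w) / f z\<close> by \<open>(1 + \<epsilon>) exp (K u Re (w / z))\<close> on a disc of
  radius about \<open>norm z / K u\<close>, while the value at the centre is one.\<close>

lemma wiman_valiron_local:
  assumes f: "f holomorphic_on UNIV"
    and M: "\<And>t. max_modulus (exp t) f = exp (\<Phi> t)"
    and sub: "\<And>x y. K x * (y - x) \<le> \<Phi> y - \<Phi> x"
    and K: "K u \<ge> 1" and st: "steady K \<delta> u" "\<delta> \<ge> 0" and \<epsilon>: "\<epsilon> > 0" "exp (\<delta> + 1 / (8 * K u)) < 1 + \<epsilon>"
    and z: "norm z = exp u" "norm (f z) = exp (\<Phi> u)"
    and w: "norm w < exp u / (4 * K u)"
  shows "norm (f (z + w) / f z - exp (of_real (K u) / z * w)) \<le> 4 * \<epsilon>"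
proof -
  define c where "c = of_real (K u) / z"
  define G where "G = (\<lambda>w. f (z + w) / f z * exp (- (c * w)))"
  define R where "R = exp u / (2 * K u)"
  have nz: "z \<noteq> 0" "f z \<noteq> 0" using z by auto
  have "R > 0" using K by (simp add: R_def)
  have "norm (G w) < 1 + \<epsilon>" if w: "norm w < R" for w
  proof -
    define \<omega> where "\<omega> = w / z"
    have \<omega>: "norm \<omega> * K u \<le> 1 / 2"
      using w z K by (simp add: \<omega>_def R_def norm_divide field_simps)
    moreover have "norm \<omega> * 1 \<le> norm \<omega> * K u" using K by (intro mult_left_mono) auto
    ultimately have \<omega>2: "norm \<omega> \<le> 1 / 2" by simp
    define s where "s = ln (norm (1 + \<omega>))"
    note s = ln_norm_one_plus[OF \<omega>2, folded s_def]
    have sK: "\<bar>s\<bar> * K u \<le> 1"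
      using \<omega> K by (intro order_trans[OF mult_right_mono[OF s(1)]]) auto
    then have "\<bar>s\<bar> \<le> 1 / K u" using K by (simp add: field_simps)
    then have "\<bar>K (u + s) - K u\<bar> * \<bar>s\<bar> \<le> \<delta> * K u * \<bar>s\<bar>"
      using st(1) by (intro mult_right_mono) (auto simp: steady_def)
    also have "\<dots> = \<delta> * (\<bar>s\<bar> * K u)" by simp
    also have "\<dots> \<le> \<delta> * 1" using sK st(2) by (intro mult_left_mono)
    finally have dev: "(K (u + s) - K u) * s \<le> \<delta>"
      using abs_ge_self[of "(K (u + s) - K u) * s"] unfolding abs_mult by simp
    have "z + w = z * (1 + \<omega>)" using nz by (simp add: \<omega>_def algebra_simps)
    then have "norm (z + w) = exp (u + s)"
      using s(3) z by (simp add: norm_mult exp_add s_def)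
    then have "norm (f (z + w)) \<le> exp (\<Phi> (u + s))"
      using norm_le_max_modulus[OF f, of "z + w"] M by simp
    then have "norm (G w) \<le> exp (\<Phi> (u + s)) / exp (\<Phi> u) * exp (- Re (c * w))"
      using z by (simp add: G_def norm_mult norm_divide divide_right_mono)
    also have "Re (c * w) = K u * Re \<omega>"
      by (simp add: c_def \<omega>_def times_divide_eq_right[symmetric] del: times_divide_eq_right)
    also have "exp (\<Phi> (u + s)) / exp (\<Phi> u) * exp (- (K u * Re \<omega>)) = exp (\<Phi> (u + s) - \<Phi> u - K u * Re \<omega>)"
      by (simp add: exp_diff exp_minus exp_add field_simps)
    also have "\<Phi> (u + s) - \<Phi> u - K u * Re \<omega> \<le> \<delta> + 1 / (8 * K u)"
    proof -
      have "\<Phi> (u + s) - \<Phi> u \<le> K (u + s) * s" using sub[of "u + s" u] by simp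
      also have "\<dots> \<le> \<delta> + K u * s" using dev by (simp add: algebra_simps)
      also have "K u * s \<le> K u * (Re \<omega> + (norm \<omega>)\<^sup>2 / 2)" using s(2) K by (intro mult_left_mono) auto
      also have "K u * (Re \<omega> + (norm \<omega>)\<^sup>2 / 2) = K u * Re \<omega> + (norm \<omega> * K u)\<^sup>2 / (2 * K u)"
        using K by (simp add: power2_eq_square field_simps)
      also have "(norm \<omega> * K u)\<^sup>2 / (2 * K u) \<le> (1 / 2)\<^sup>2 / (2 * K u)"
        using \<omega> K by (intro divide_right_mono power_mono) auto
      finally show ?thesis by (simp add: power2_eq_square)
    qed
    finally show ?thesis using \<epsilon>(2) by simp
  qed
  moreover have "G holomorphic_on ball 0 R"
    unfolding G_def by (intro holomorphic_intros holomorphic_on_compose_gen[OF _ f, unfolded o_def] nz) auto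
  moreover have "G 0 = 1" using nz by (simp add: G_def)
  moreover have "norm w < R / 2" using w by (simp add: R_def)
  ultimately have "norm (G w - 1) \<le> 2 * \<epsilon>"
    using norm_diff_one_le \<open>R > 0\<close> \<epsilon>(1) by blast
  moreover have "norm (exp (c * w)) \<le> 2"
  proof -
    have "norm (c * w) \<le> 1 / 4"
      using w K z by (simp add: c_def norm_mult norm_divide field_simps)
    then show ?thesis by (intro exp_bound_half) simp
  qed
  ultimately have "norm ((G w - 1) * exp (c * w)) \<le> 2 * \<epsilon> * 2"
    unfolding norm_mult using \<epsilon> by (intro mult_mono) auto
  also have "(G w - 1) * exp (c * w) = f (z + w) / f z - exp (c * w)"
    by (simp add: G_def algebra_simps exp_minus)
  finally show ?thesis by (simp add: c_def)
qed


lemma exp_minus_one_power_near: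
  fixes \<epsilon> :: real
  assumes "\<epsilon> > 0"
  shows "\<exists>\<rho>>0. \<forall>k\<le>n. \<forall>x::complex. norm x < \<rho> \<longrightarrow> norm ((exp x - 1) ^ k - x ^ k) \<le> \<epsilon> * norm x ^ k"
proof -
  have "((\<lambda>x. (exp x - 1) / x) \<longlongrightarrow> (1::complex)) (at 0)"
    using DERIV_exp[of "0::complex"] by (simp add: DERIV_def)
  then have lim: "((\<lambda>x. ((exp x - 1) / x) ^ k) \<longlongrightarrow> (1::complex)) (at 0)" for k
    using tendsto_power[of _ "1::complex" _ k] by fastforce
  have "eventually (\<lambda>x. \<forall>k\<in>{..n}. dist (((exp x - 1) / x) ^ k) (1::complex) < \<epsilon>) (at 0)"
    using tendstoD[OF lim assms] by (intro eventually_ball_finite) auto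
  then obtain \<rho> where \<rho>: "\<rho> > 0"
    "\<And>x k. x \<noteq> 0 \<Longrightarrow> norm x < \<rho> \<Longrightarrow> k \<le> n \<Longrightarrow> norm (((exp x - 1) / x) ^ k - (1::complex)) < \<epsilon>"
    by (auto simp: eventually_at dist_norm)
  show ?thesis
  proof (intro exI[of _ \<rho>] conjI allI impI \<rho>(1))
    fix k and x :: complex assume k: "k \<le> n" and x: "norm x < \<rho>"
    show "norm ((exp x - 1) ^ k - x ^ k) \<le> \<epsilon> * norm x ^ k"
    proof (cases "x = 0")
      case True
      then show ?thesis using assms by (cases k) auto
    next
      case False
      then have "(exp x - 1) ^ k - x ^ k = (((exp x - 1) / x) ^ k - 1) * x ^ k"
        by (simp add: power_divide field_simps)
      then show ?thesis
        using \<rho>(2)[OF False x k] by (simp add: norm_mult norm_power mult_right_mono)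
    qed
  qed
qed

text \<open>The function \<open>exp (c * w)\<close> with \<open>c = K u / z\<close> has \<open>k\<close>-th difference \<open>(exp (c * \<eta>) - 1) ^ k\<close> at
  \<open>0\<close>, which is near \<open>(c * \<eta>) ^ k\<close> as \<open>c * \<eta>\<close> tends to zero. The difference between it and
  \<open>f (z + w) / f z\<close> is entire and small on a large disc.\<close>

lemma wiman_valiron_differences:
  assumes f: "f holomorphic_on UNIV"
    and M: "\<And>t. max_modulus (exp t) f = exp (\<Phi> t)"
    and sub: "\<And>x y. K x * (y - x) \<le> \<Phi> y - \<Phi> x"
    and K: "filterlim K at_top at_top" and small: "((\<lambda>t. K t / exp t) \<longlongrightarrow> 0) at_top"
    and \<epsilon>: "\<epsilon> > 0"
  shows "\<exists>\<delta>>0. eventually (\<lambda>u. steady K \<delta> u \<longrightarrow>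
    (\<forall>k\<le>n. \<forall>z. norm z = exp u \<longrightarrow> norm (f z) = exp (\<Phi> u) \<longrightarrow>
      norm ((fdiff \<eta> ^^ k) f z / f z - (\<eta> * of_real (K u) / z) ^ k) \<le> \<epsilon> * (norm \<eta> * K u / exp u) ^ k)) at_top"
proof -
  define C where "C = (2 ^ (n + 3)) ^ n * (1::real)"
  have C: "C > 0" "\<And>k. k \<le> n \<Longrightarrow> (2 ^ (k + 3)) ^ k \<le> C"
  proof -
    show "(2 ^ (k + 3)) ^ k \<le> C" if "k \<le> n" for k
    proof -
      have "((2 ^ (k + 3)) ^ k :: real) \<le> (2 ^ (n + 3)) ^ k"
        using that by (intro power_mono power_increasing) auto
      also have "\<dots> \<le> (2 ^ (n + 3)) ^ n" using that by (intro power_increasing) auto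
      finally show ?thesis by (simp add: C_def)
    qed
  qed (simp add: C_def)
  (* funpow_fdiff_bound with bound 4 * \<epsilon>' on radius exp u / (4 * K u) yields the factor
     4 * \<epsilon>' * C, which is half of \<epsilon>; the other half pays for exp x - 1 against x *)
  define \<epsilon>' where "\<epsilon>' = \<epsilon> / (8 * C)"
  have \<epsilon>': "\<epsilon>' > 0" using \<epsilon> C by (simp add: \<epsilon>'_def)
  (* of the exponent ln (1 + \<epsilon>'), one half is for steadiness and one half for 1 / (8 * K u) *)
  define \<delta> where "\<delta> = ln (1 + \<epsilon>') / 2"
  have \<delta>: "\<delta> > 0" "exp (\<delta> + \<delta>) = 1 + \<epsilon>'" using \<epsilon>' by (simp_all add: \<delta>_def)
  obtain \<rho> where \<rho>: "\<rho> > 0" "\<And>k x. k \<le> n \<Longrightarrow> norm x < \<rho> \<Longrightarrow>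
      norm ((exp x - 1) ^ k - x ^ k) \<le> \<epsilon> / 2 * norm (x::complex) ^ k"
    using exp_minus_one_power_near[of "\<epsilon> / 2" n] \<epsilon> by auto
  have "((\<lambda>u. norm \<eta> * (K u / exp u)) \<longlongrightarrow> norm \<eta> * 0) at_top"
    by (intro tendsto_mult tendsto_const small)
  then have "eventually (\<lambda>u. norm \<eta> * (K u / exp u) < min \<rho> (1 / 2 ^ (n + 3))) at_top"
    using \<rho>(1) by (intro order_tendstoD) auto
  moreover have "eventually (\<lambda>u. K u > max 1 (1 / (8 * \<delta>))) at_top"
    using K unfolding filterlim_at_top_dense by blast
  ultimately have "eventually (\<lambda>u. steady K \<delta> u \<longrightarrow>
    (\<forall>k\<le>n. \<forall>z. norm z = exp u \<longrightarrow> norm (f z) = exp (\<Phi> u) \<longrightarrow>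
      norm ((fdiff \<eta> ^^ k) f z / f z - (\<eta> * of_real (K u) / z) ^ k) \<le> \<epsilon> * (norm \<eta> * K u / exp u) ^ k)) at_top"
  proof eventually_elim
    case (elim u)
    show ?case
    proof (intro impI allI)
      fix k z assume st: "steady K \<delta> u" and k: "k \<le> n"
        and z: "norm z = exp u" "norm (f z) = exp (\<Phi> u)"
      have Ku: "K u \<ge> 1" "K u > 0" "1 / (8 * K u) < \<delta>"
        using elim(2) \<delta>(1) by (auto simp: field_simps)
      have nz: "z \<noteq> 0" "f z \<noteq> 0" using z by auto
      define R where "R = exp u / (4 * K u)"
      have R: "R > 0" using Ku by (simp add: R_def)
      define c where "c = of_real (K u) / z"
      have c: "norm (c * \<eta>) = norm \<eta> * K u / exp u"
        using Ku z by (simp add: c_def norm_mult norm_divide)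
      define e where "e = (\<lambda>w. 1 / f z * f (z + w) + (-1) * exp (c * (0 + w)))"
      have eD: "(fdiff \<eta> ^^ k) e 0 = (fdiff \<eta> ^^ k) f z / f z - (exp (c * \<eta>) - 1) ^ k"
        unfolding e_def funpow_fdiff_add funpow_fdiff_shift
        by (subst funpow_fdiff_shift[of _ _ _ "\<lambda>w. exp (c * w)"]) (simp add: funpow_fdiff_exp)
      have "norm ((fdiff \<eta> ^^ k) e 0) \<le> 4 * \<epsilon>' * (2 ^ (k + 1) * norm \<eta> / R) ^ k"
      proof (rule funpow_fdiff_bound)
        show "e holomorphic_on UNIV"
          unfolding e_def by (intro holomorphic_intros holomorphic_on_compose_gen[OF _ f, unfolded o_def] nz) auto
        show "norm (e w) \<le> 4 * \<epsilon>'" if "norm w < R" for w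
        proof -
          have "exp (\<delta> + 1 / (8 * K u)) < 1 + \<epsilon>'"
            unfolding \<delta>(2)[symmetric] using Ku by simp
          then show ?thesis
            using wiman_valiron_local[OF f M sub Ku(1) st _ \<epsilon>' _ z, of w] \<delta>(1) that
            by (simp add: e_def c_def R_def)
        qed
        have "norm \<eta> * K u / exp u * 2 ^ (k + 3) \<le> norm \<eta> * K u / exp u * 2 ^ (n + 3)"
          using k Ku by (intro mult_left_mono power_increasing) auto
        also have "\<dots> \<le> 1" using elim(1) by (simp add: field_simps)
        finally show "norm \<eta> \<le> R / 2 ^ (k + 1)"
          using Ku by (simp add: R_def power_add field_simps)
      qed (use R \<epsilon>' in auto)
      also have "2 ^ (k + 1) * norm \<eta> / R = 2 ^ (k + 3) * (norm \<eta> * K u / exp u)"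
        by (simp add: R_def power_add)
      also have "4 * \<epsilon>' * (2 ^ (k + 3) * (norm \<eta> * K u / exp u)) ^ k
          = 4 * \<epsilon>' * (2 ^ (k + 3)) ^ k * (norm \<eta> * K u / exp u) ^ k"
        by (simp only: power_mult_distrib mult.assoc)
      also have "\<dots> \<le> 4 * \<epsilon>' * C * (norm \<eta> * K u / exp u) ^ k"
        using C(2)[OF k] \<epsilon>' Ku by (intro mult_right_mono mult_left_mono) auto
      also have "\<dots> = \<epsilon> / 2 * (norm \<eta> * K u / exp u) ^ k"
        using C by (simp add: \<epsilon>'_def)
      finally have 1: "norm ((fdiff \<eta> ^^ k) e 0) \<le> \<epsilon> / 2 * (norm \<eta> * K u / exp u) ^ k" .
      have "norm ((exp (c * \<eta>) - 1) ^ k - (c * \<eta>) ^ k) \<le> \<epsilon> / 2 * norm (c * \<eta>) ^ k"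
        using elim(1) by (intro \<rho>(2) k) (simp add: c)
      then have "norm ((fdiff \<eta> ^^ k) e 0 + ((exp (c * \<eta>) - 1) ^ k - (c * \<eta>) ^ k))
          \<le> \<epsilon> * (norm \<eta> * K u / exp u) ^ k"
        using 1 unfolding c by (intro norm_triangle_le) simp
      then show "norm ((fdiff \<eta> ^^ k) f z / f z - (\<eta> * of_real (K u) / z) ^ k)
          \<le> \<epsilon> * (norm \<eta> * K u / exp u) ^ k"
        unfolding eD by (simp add: c_def mult.commute)
    qed
  qed
  with \<delta>(1) show ?thesis by blast
qed

section \<open>The Newton polygon and the characteristic equations\<close>

text \<open>If \<open>e j\<close> is the ordinate over \<open>j\<close> in Newton's diagram, then for a slope \<open>- \<sigma>\<close> of an edge this
  is the set of the points on that edge; for other \<open>\<sigma>\<close> it is a single vertex.\<close>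

definition tight :: "nat set \<Rightarrow> (nat \<Rightarrow> real) \<Rightarrow> real \<Rightarrow> nat set" where
  "tight J e \<sigma> = {j\<in>J. \<forall>l\<in>J. e l + \<sigma> * real l \<le> e j + \<sigma> * real j}"

text \<open>The \<open>\<sigma>\<close> for which \<open>i\<close> and \<open>j\<close> have the same value \<open>e l + \<sigma> * l\<close>.\<close>

definition tie_exponent :: "(nat \<Rightarrow> real) \<Rightarrow> nat \<Rightarrow> nat \<Rightarrow> real" where
  "tie_exponent e i j = (e i - e j) / (real j - real i)"

definition characteristic :: "nat set \<Rightarrow> (nat \<Rightarrow> complex) \<Rightarrow> (nat \<Rightarrow> real) \<Rightarrow> real \<Rightarrow> complex poly" where
  "characteristic J b e \<sigma> = (\<Sum>l\<in>tight J e \<sigma>. monom (b l) l)"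

text \<open>The pairs \<open>(s, \<sigma>)\<close> for which \<open>K u\<close> may be near \<open>s * exp (\<sigma> * u)\<close>: \<open>- \<sigma>\<close> is the slope of an edge.
  Only moduli of roots are recorded, since the argument of the root varies with that of \<open>z\<close>.\<close>

definition growth_pairs :: "nat set \<Rightarrow> (nat \<Rightarrow> complex) \<Rightarrow> (nat \<Rightarrow> real) \<Rightarrow> (real \<times> real) set" where
  "growth_pairs J b e = {(norm x, tie_exponent e i j) | x i j.
     i \<in> J \<and> j \<in> J \<and> i \<noteq> j \<and> {i, j} \<subseteq> tight J e (tie_exponent e i j) \<and>
     x \<noteq> 0 \<and> poly (characteristic J b e (tie_exponent e i j)) x = 0}"

lemma characteristic_nonzero:
  assumes "finite J" "\<And>j. j \<in> J \<Longrightarrow> b j \<noteq> 0" "i \<in> tight J e \<sigma>"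
  shows "characteristic J b e \<sigma> \<noteq> 0"
proof -
  have fin: "finite (tight J e \<sigma>)" using assms(1) by (simp add: tight_def)
  have "coeff (characteristic J b e \<sigma>) i = (\<Sum>l\<in>tight J e \<sigma>. if l = i then b l else 0)"
    by (simp add: characteristic_def coeff_sum coeff_monom)
  also have "\<dots> = b i" using assms(3) fin by (subst sum.delta) auto
  also have "\<dots> \<noteq> 0" using assms by (auto simp: tight_def)
  finally show ?thesis by (metis coeff_0)
qed

lemma finite_growth_pairs:
  assumes "finite J" "\<And>j. j \<in> J \<Longrightarrow> b j \<noteq> 0"
  shows "finite (growth_pairs J b e)"
proof -
  define T where "T = {(i, j) \<in> J \<times> J. i \<in> tight J e (tie_exponent e i j)}"
  define Q where "Q = (\<lambda>(i, j). (\<lambda>x. (norm x, tie_exponent e i j)) ` {x. poly (characteristic J b e (tie_exponent e i j)) x = 0})"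
  have "finite T" by (rule finite_subset[of _ "J \<times> J"]) (use assms(1) in \<open>auto simp: T_def\<close>)
  moreover have "finite (Q p)" if "p \<in> T" for p
    using that characteristic_nonzero[OF assms] by (auto simp: T_def Q_def intro!: poly_roots_finite)
  ultimately have "finite (\<Union>p\<in>T. Q p)" by blast
  moreover have "growth_pairs J b e \<subseteq> (\<Union>p\<in>T. Q p)"
    by (force simp: growth_pairs_def T_def Q_def)
  ultimately show ?thesis by (rule finite_subset[rotated])
qed

text \<open>By compactness, a small value of a polynomial on an annulus forces the modulus of the argument
  to be near that of a root.\<close>

lemma small_value_near_root:
  fixes p :: "complex poly"
  assumes "0 < \<epsilon>"
  shows "\<exists>\<mu>>0. \<forall>x. exp (- C) \<le> norm x \<and> norm x \<le> exp C \<and> norm (poly p x) < \<mu> \<longrightarrow>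
    (\<exists>y. y \<noteq> 0 \<and> poly p y = 0 \<and> \<bar>norm x - norm y\<bar> < \<epsilon> * norm y)"
proof -
  define A where "A = cball (0::complex) (exp C) \<inter> ({x. exp (- C) \<le> norm x} \<inter>
    (\<Inter>y\<in>{y. y \<noteq> 0 \<and> poly p y = 0}. {x. \<epsilon> * norm y \<le> \<bar>norm x - norm y\<bar>}))"
  have "compact A"
    unfolding A_def
    by (intro compact_Int_closed closed_Int closed_INT closed_Collect_le continuous_intros ballI)
       (rule compact_cball)
  show ?thesis
  proof (cases "A = {}")
    case True
    then show ?thesis by (intro exI[of _ 1]) (auto simp: A_def not_le, force)
  next
    case False
    have "continuous_on A (\<lambda>x. norm (poly p x))" by (intro continuous_intros)
    then obtain x0 where x0: "x0 \<in> A" "\<And>x. x \<in> A \<Longrightarrow> norm (poly p x0) \<le> norm (poly p x)"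
      using continuous_attains_inf[OF \<open>compact A\<close> False] by blast
    have "x0 \<noteq> 0" using x0(1) by (auto simp: A_def)
    have "poly p x0 \<noteq> 0"
    proof
      assume "poly p x0 = 0"
      with \<open>x0 \<noteq> 0\<close> have "\<epsilon> * norm x0 \<le> \<bar>norm x0 - norm x0\<bar>"
        using x0(1) unfolding A_def by blast
      with \<open>x0 \<noteq> 0\<close> assms show False by (simp add: mult_le_0_iff)
    qed
    then show ?thesis
      using x0(2) by (intro exI[of _ "norm (poly p x0)"]) (force simp: A_def not_le)
  qed
qed

text \<open>Newton's polygon. If a sum of terms of size \<open>exp (e l * u + \<kappa> * l)\<close> nearly cancels, the
  two largest terms are comparable, which puts \<open>\<kappa>\<close> within a bounded distance of \<open>\<sigma> * u\<close> for
  one of finitely many \<open>\<sigma>\<close>. For large \<open>u\<close> the terms off the edge of slope \<open>- \<sigma>\<close> are negligible,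
  and those on it sum up to the characteristic polynomial at \<open>exp (\<kappa> - \<sigma> * w)\<close>.\<close>

lemma cancellation_near_growth_pair:
  fixes b :: "nat \<Rightarrow> complex" and e :: "nat \<Rightarrow> real"
  assumes J: "finite J" and b: "\<And>j. j \<in> J \<Longrightarrow> b j \<noteq> 0" and \<epsilon>: "\<epsilon> > 0"
    and i: "i \<in> J" and j: "j \<in> J" and ij: "i \<noteq> j"
  shows "eventually (\<lambda>U. \<forall>w (\<kappa>::real). U \<le> Re w \<longrightarrow>
    (\<forall>l\<in>J. norm (b l) * exp (e l * Re w + \<kappa> * l) \<le> norm (b i) * exp (e i * Re w + \<kappa> * i)) \<longrightarrow>
    norm (b i) * exp (e i * Re w + \<kappa> * i) \<le> 2 * card J * (norm (b j) * exp (e j * Re w + \<kappa> * j)) \<longrightarrow>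
    norm (\<Sum>l\<in>J. b l * exp (of_real (e l) * w + of_real (\<kappa> * l))) \<le> 1 / U * (norm (b i) * exp (e i * Re w + \<kappa> * i)) \<longrightarrow>
    (\<exists>(s, \<sigma>)\<in>growth_pairs J b e. \<bar>exp (\<kappa> - \<sigma> * Re w) - s\<bar> \<le> \<epsilon> * s)) at_top"
proof -
  define \<sigma> where "\<sigma> = tie_exponent e i j"
  define m where "m = e i + \<sigma> * i"
  have mj: "m = e j + \<sigma> * j"
    using ij by (simp add: m_def \<sigma>_def tie_exponent_def field_simps)
  have N: "real (card J) \<ge> 1" using J i by (metis One_nat_def Suc_leI card_gt_0_iff empty_iff of_nat_1 of_nat_mono)
  define L where "L = (\<Sum>l\<in>J. \<bar>ln (norm (b l))\<bar>)"
  have L: "\<bar>ln (norm (b l))\<bar> \<le> L" if "l \<in> J" for l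
    unfolding L_def using J that by (intro member_le_sum) auto
  define C where "C = ln (2 * card J) + 2 * L"
  have C: "C \<ge> 2 * L" "C \<ge> 0" using N L[OF i] by (simp_all add: C_def add_nonneg_nonneg)
  define n where "n = real (Max J)"
  have n: "real l \<le> n" if "l \<in> J" for l using J that by (simp add: n_def)
  obtain \<mu> where \<mu>: "\<mu> > 0" "\<And>x. exp (- C) \<le> norm x \<Longrightarrow> norm x \<le> exp C \<Longrightarrow> norm (poly (characteristic J b e \<sigma>) x) < \<mu>
      \<Longrightarrow> \<exists>y. y \<noteq> 0 \<and> poly (characteristic J b e \<sigma>) y = 0 \<and> \<bar>norm x - norm y\<bar> < \<epsilon> * norm y"
    using small_value_near_root[OF \<epsilon>, of C] by metis
  (* no l with e l + \<sigma> * l > m can be dominated by i once U exceeds this bound *)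
  have gap: "eventually (\<lambda>U. \<forall>l\<in>J. e l + \<sigma> * l > m \<longrightarrow> (e l + \<sigma> * l - m) * U > 2 * (C + n * C)) at_top"
  proof (intro eventually_ball_finite J ballI)
    fix l
    show "eventually (\<lambda>U. e l + \<sigma> * l > m \<longrightarrow> (e l + \<sigma> * l - m) * U > 2 * (C + n * C)) at_top"
    proof (cases "e l + \<sigma> * l > m")
      case True
      then show ?thesis
        using eventually_gt_at_top[of "2 * (C + n * C) / (e l + \<sigma> * l - m)"]
        by (simp add: pos_divide_less_eq mult.commute)
    qed simp
  qed
  have tail: "eventually (\<lambda>U. (\<Sum>l\<in>J - tight J e \<sigma>. norm (b l) * exp (n * C) * exp ((e l + \<sigma> * l - m) * U))
      + 1 / U * (norm (b i) * exp (n * C)) < \<mu>) at_top" if "i \<in> tight J e \<sigma>"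
  proof (rule order_tendstoD(2))
    have "((\<lambda>U. norm (b l) * exp (n * C) * exp ((e l + \<sigma> * l - m) * U)) \<longlongrightarrow> 0) at_top"
      if l: "l \<in> J - tight J e \<sigma>" for l
    proof -
      have "e l + \<sigma> * l < m"
        using l \<open>i \<in> tight J e \<sigma>\<close> by (force simp: tight_def m_def)
      then have "- (e l + \<sigma> * l - m) > 0" by simp
      moreover have "((\<lambda>U::real. exp (- d * U)) \<longlongrightarrow> 0) at_top" if "d > 0" for d :: real
        using that by real_asymp
      ultimately have "((\<lambda>U. exp (- (- (e l + \<sigma> * l - m)) * U)) \<longlongrightarrow> 0) at_top" by blast
      then show ?thesis by (intro tendsto_mult_right_zero) simp
    qed
    then have "((\<lambda>U. \<Sum>l\<in>J - tight J e \<sigma>. norm (b l) * exp (n * C) * exp ((e l + \<sigma> * l - m) * U)) \<longlongrightarrow> 0) at_top"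
      by (rule tendsto_null_sum)
    moreover have "((\<lambda>U. 1 / U * (norm (b i) * exp (n * C))) \<longlongrightarrow> 0) at_top"
      by (intro tendsto_mult_left_zero) real_asymp
    ultimately show "((\<lambda>U. (\<Sum>l\<in>J - tight J e \<sigma>. norm (b l) * exp (n * C) * exp ((e l + \<sigma> * l - m) * U))
      + 1 / U * (norm (b i) * exp (n * C))) \<longlongrightarrow> 0) at_top"
      using tendsto_add by fastforce
  qed (rule \<mu>(1))
  have "eventually (\<lambda>U. i \<in> tight J e \<sigma> \<longrightarrow> (\<Sum>l\<in>J - tight J e \<sigma>. norm (b l) * exp (n * C) * exp ((e l + \<sigma> * l - m) * U))
      + 1 / U * (norm (b i) * exp (n * C)) < \<mu>) at_top"
    using tail by (cases "i \<in> tight J e \<sigma>") auto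
  with gap show ?thesis
    using eventually_gt_at_top[of 0]
  proof eventually_elim
    case (elim U)
    show ?case
    proof (intro allI impI)
      fix w and \<kappa> :: real
      define u where "u = Re w"
      define T where "T = (\<lambda>l. norm (b l) * exp (e l * u + \<kappa> * l))"
      assume U: "U \<le> Re w"
        and dom: "\<forall>l\<in>J. norm (b l) * exp (e l * Re w + \<kappa> * l) \<le> norm (b i) * exp (e i * Re w + \<kappa> * i)"
        and sec: "norm (b i) * exp (e i * Re w + \<kappa> * i) \<le> 2 * card J * (norm (b j) * exp (e j * Re w + \<kappa> * j))"
        and canc: "norm (\<Sum>l\<in>J. b l * exp (of_real (e l) * w + of_real (\<kappa> * l))) \<le> 1 / U * (norm (b i) * exp (e i * Re w + \<kappa> * i))"
      define y where "y = \<kappa> - \<sigma> * u"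
      have exponent: "e l * u + \<kappa> * l = (e l + \<sigma> * l) * u + y * l" for l
        by (simp add: y_def algebra_simps)
      have lnT: "ln (T l) = ln (norm (b l)) + (e l + \<sigma> * l) * u + y * l" and Tpos: "T l > 0" if "l \<in> J" for l
        using b[OF that] by (simp_all add: T_def exponent ln_mult)
      have domT: "ln (T l) \<le> ln (T i)" if "l \<in> J" for l
        using dom that Tpos[OF that] Tpos[OF i] by (simp add: T_def u_def)
      have "ln (T i) \<le> ln (2 * card J * T j)"
        using sec Tpos[OF i] Tpos[OF j] N by (intro ln_mono) (auto simp: T_def u_def)
      also have "\<dots> = ln (2 * card J) + ln (T j)"
        using Tpos[OF j] N by (simp add: ln_mult)
      finally have "\<bar>y * (real i - real j)\<bar> \<le> C"
        using domT[OF j] L[OF i] L[OF j] N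
        by (simp add: lnT i j C_def m_def[symmetric] mj[symmetric] algebra_simps abs_le_iff)
      moreover have "\<bar>y\<bar> * 1 \<le> \<bar>y\<bar> * \<bar>real i - real j\<bar>"
        using ij by (intro mult_left_mono) auto
      ultimately have y: "\<bar>y\<bar> \<le> C" by (simp add: abs_mult)
      have yl: "\<bar>y * l\<bar> \<le> n * C" if "l \<in> J" for l
        using y n[OF that] C(2) mult_mono[of "real l" n "\<bar>y\<bar>" C] by (simp add: abs_mult mult.commute)
      have le_m: "e l + \<sigma> * l \<le> m" if l: "l \<in> J" for l
      proof (rule ccontr)
        assume gt: "\<not> e l + \<sigma> * l \<le> m"
        then have "(e l + \<sigma> * l - m) * U \<le> (e l + \<sigma> * l - m) * u"
          using U by (intro mult_left_mono) (auto simp: u_def)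
        moreover have "(e l + \<sigma> * l - m) * u \<le> 2 * (C + n * C)"
          using domT[OF l] L[OF i] L[OF l] yl[OF i] yl[OF l] C(1)
          unfolding lnT[OF i] lnT[OF l] m_def[symmetric] abs_le_iff left_diff_distrib distrib_left by linarith
        ultimately have "(e l + \<sigma> * l - m) * U \<le> 2 * (C + n * C)" by (rule order_trans)
        moreover have "2 * (C + n * C) < (e l + \<sigma> * l - m) * U"
          using elim(1) l gt by (simp only: not_le)
        ultimately show False by (metis not_le)
      qed
      then have "i \<in> tight J e \<sigma>" "j \<in> tight J e \<sigma>"
        using i j by (auto simp: tight_def m_def[symmetric] mj[symmetric])
      have tight: "e l + \<sigma> * l = m" if "l \<in> tight J e \<sigma>" for l
        using that le_m i by (force simp: tight_def m_def)
      define x where "x = exp (of_real \<kappa> - of_real \<sigma> * w)"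
      have x: "norm x = exp y" by (simp add: x_def y_def u_def)
      define rest where "rest = (\<Sum>l\<in>J - tight J e \<sigma>. b l * exp (of_real (e l + \<sigma> * l - m) * w) * x ^ l)"
      have "(\<Sum>l\<in>J. b l * exp (of_real (e l) * w + of_real (\<kappa> * l)))
          = exp (of_real m * w) * (\<Sum>l\<in>J. b l * exp (of_real (e l + \<sigma> * l - m) * w) * x ^ l)"
        unfolding sum_distrib_left
      proof (rule sum.cong)
        fix l
        have "of_real (e l) * w + of_real (\<kappa> * l)
            = of_real m * w + (of_real (e l + \<sigma> * l - m) * w + of_nat l * (of_real \<kappa> - of_real \<sigma> * w))"
          by (simp add: algebra_simps)
        then show "b l * exp (of_real (e l) * w + of_real (\<kappa> * l))
            = exp (of_real m * w) * (b l * exp (of_real (e l + \<sigma> * l - m) * w) * x ^ l)"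
          by (simp only: exp_add x_def exp_of_nat_mult mult_ac)
      qed simp
      also have "(\<Sum>l\<in>J. b l * exp (of_real (e l + \<sigma> * l - m) * w) * x ^ l)
          = rest + (\<Sum>l\<in>tight J e \<sigma>. b l * exp (of_real (e l + \<sigma> * l - m) * w) * x ^ l)"
        unfolding rest_def using J by (intro sum.subset_diff) (auto simp: tight_def)
      also have "(\<Sum>l\<in>tight J e \<sigma>. b l * exp (of_real (e l + \<sigma> * l - m) * w) * x ^ l)
          = poly (characteristic J b e \<sigma>) x"
        unfolding characteristic_def poly_sum poly_monom by (intro sum.cong) (auto simp: tight)
      finally have "exp (m * u) * norm (rest + poly (characteristic J b e \<sigma>) x)
          \<le> 1 / U * (norm (b i) * exp (m * u + y * i))"
        using canc exponent[of i] by (simp add: norm_mult u_def m_def)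
      also have "\<dots> = exp (m * u) * (1 / U * (norm (b i) * exp (y * i)))"
        by (simp add: exp_add)
      finally have "norm (rest + poly (characteristic J b e \<sigma>) x) \<le> 1 / U * (norm (b i) * exp (y * i))"
        by (rule mult_left_le_imp_le) simp
      also have "\<dots> \<le> 1 / U * (norm (b i) * exp (n * C))"
        using yl[OF i] elim(3) by (intro mult_left_mono) (auto simp: abs_le_iff)
      finally have small: "norm (rest + poly (characteristic J b e \<sigma>) x) \<le> 1 / U * (norm (b i) * exp (n * C))" .
      have "norm rest \<le> (\<Sum>l\<in>J - tight J e \<sigma>. norm (b l) * exp (n * C) * exp ((e l + \<sigma> * l - m) * U))"
        unfolding rest_def
      proof (rule sum_norm_le)
        fix l assume l: "l \<in> J - tight J e \<sigma>"
        have "(e l + \<sigma> * l - m) * u \<le> (e l + \<sigma> * l - m) * U"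
          using l le_m[of l] U by (intro mult_left_mono_neg) (auto simp: u_def)
        moreover have "norm (x ^ l) \<le> exp (n * C)"
          using yl[of l] l by (simp add: norm_power x exp_of_nat_mult[symmetric] mult.commute abs_le_iff)
        ultimately have "norm (b l) * exp ((e l + \<sigma> * l - m) * u) * norm (x ^ l)
            \<le> norm (b l) * exp ((e l + \<sigma> * l - m) * U) * exp (n * C)"
          by (intro mult_mono) auto
        then show "norm (b l * exp (of_real (e l + \<sigma> * l - m) * w) * x ^ l)
            \<le> norm (b l) * exp (n * C) * exp ((e l + \<sigma> * l - m) * U)"
          by (simp add: norm_mult u_def mult_ac)
      qed
      moreover have "norm (poly (characteristic J b e \<sigma>) x)
          \<le> norm (rest + poly (characteristic J b e \<sigma>) x) + norm rest"
        using norm_triangle_ineq4[of "rest + poly (characteristic J b e \<sigma>) x" rest] by simp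
      ultimately have "norm (poly (characteristic J b e \<sigma>) x) < \<mu>"
        using small elim(2) \<open>i \<in> tight J e \<sigma>\<close> by simp
      then obtain r where r: "r \<noteq> 0" "poly (characteristic J b e \<sigma>) r = 0" "\<bar>exp y - norm r\<bar> < \<epsilon> * norm r"
        using \<mu>(2)[of x] y x by (auto simp: abs_le_iff)
      then have "(norm r, \<sigma>) \<in> growth_pairs J b e"
        using i j ij \<open>i \<in> tight J e \<sigma>\<close> \<open>j \<in> tight J e \<sigma>\<close> unfolding growth_pairs_def \<sigma>_def by blast
      with r(3) show "\<exists>(s, \<sigma>)\<in>growth_pairs J b e. \<bar>exp (\<kappa> - \<sigma> * Re w) - s\<bar> \<le> \<epsilon> * s"
        by (intro bexI[of _ "(norm r, \<sigma>)"]) (auto simp: y_def u_def)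
    qed
  qed
qed


text \<open>The largest term \<open>i\<close> must be compensated by another term \<open>j\<close> of size at least \<open>1 / (2 * card J)\<close>
  times its own.\<close>

lemma near_cancellation:
  fixes b :: "nat \<Rightarrow> complex" and e :: "nat \<Rightarrow> real"
  assumes J: "finite J" "J \<noteq> {}" and "\<forall>j\<in>J. b j \<noteq> 0" and \<epsilon>: "\<epsilon> > 0"
  shows "\<exists>\<delta>>0. \<exists>U. \<forall>w (\<kappa>::real). U \<le> Re w \<longrightarrow>
    norm (\<Sum>l\<in>J. b l * exp (of_real (e l) * w + of_real (\<kappa> * l)))
      \<le> \<delta> * (\<Sum>l\<in>J. norm (b l) * exp (e l * Re w + \<kappa> * l)) \<longrightarrow>
    (\<exists>(s, \<sigma>)\<in>growth_pairs J b e. \<bar>exp (\<kappa> - \<sigma> * Re w) - s\<bar> \<le> \<epsilon> * s)"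
proof -
  have b: "b j \<noteq> 0" if "j \<in> J" for j using assms(3) that by blast
  define P where "P = (\<lambda>i j U. \<forall>w (\<kappa>::real). U \<le> Re w \<longrightarrow>
    (\<forall>l\<in>J. norm (b l) * exp (e l * Re w + \<kappa> * l) \<le> norm (b i) * exp (e i * Re w + \<kappa> * i)) \<longrightarrow>
    norm (b i) * exp (e i * Re w + \<kappa> * i) \<le> 2 * card J * (norm (b j) * exp (e j * Re w + \<kappa> * j)) \<longrightarrow>
    norm (\<Sum>l\<in>J. b l * exp (of_real (e l) * w + of_real (\<kappa> * l))) \<le> 1 / U * (norm (b i) * exp (e i * Re w + \<kappa> * i)) \<longrightarrow>
    (\<exists>(s, \<sigma>)\<in>growth_pairs J b e. \<bar>exp (\<kappa> - \<sigma> * Re w) - s\<bar> \<le> \<epsilon> * s))"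
  have "eventually (\<lambda>U. \<forall>i\<in>J. \<forall>j\<in>J. i \<noteq> j \<longrightarrow> P i j U) at_top"
    using cancellation_near_growth_pair[OF J(1) b \<epsilon>] J(1)
    by (intro eventually_ball_finite ballI) (auto simp: P_def)
  then have "eventually (\<lambda>U. (\<forall>i\<in>J. \<forall>j\<in>J. i \<noteq> j \<longrightarrow> P i j U) \<and> U \<ge> 3) at_top"
    using eventually_ge_at_top by (rule eventually_conj)
  then obtain U where U: "\<And>i j. i \<in> J \<Longrightarrow> j \<in> J \<Longrightarrow> i \<noteq> j \<Longrightarrow> P i j U" "U \<ge> 3"
    using eventually_happens'[OF trivial_limit_at_top_linorder] by blast
  define N where "N = real (card J)"
  have N: "N \<ge> 1" using J by (simp add: N_def Suc_leI card_gt_0_iff)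
  have "1 / (U * N) > 0" using U N by simp
  then show ?thesis
  proof (rule exI[of _ "1 / (U * N)", OF conjI[OF _ exI[of _ U]]], intro allI impI)
    fix w and \<kappa> :: real
    define T where "T = (\<lambda>l. norm (b l) * exp (e l * Re w + \<kappa> * l))"
    assume w: "U \<le> Re w"
      and small: "norm (\<Sum>l\<in>J. b l * exp (of_real (e l) * w + of_real (\<kappa> * l)))
        \<le> 1 / (U * N) * (\<Sum>l\<in>J. norm (b l) * exp (e l * Re w + \<kappa> * l))"
    have Tpos: "T l > 0" if "l \<in> J" for l using b[OF that] by (simp add: T_def)
    have normT: "norm (b l * exp (of_real (e l) * w + of_real (\<kappa> * l))) = T l" for l
      by (simp add: norm_mult T_def)
    have "Max (T ` J) \<in> T ` J" using J by (intro Max_in) auto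
    then obtain i where i: "i \<in> J" "T i = Max (T ` J)" by force
    have dom: "T l \<le> T i" if "l \<in> J" for l unfolding i(2) using J that by (intro Max_ge) auto
    have "(\<Sum>l\<in>J. T l) \<le> N * T i" unfolding N_def using sum_bounded_above[of J T "T i"] dom by simp
    then have "1 / (U * N) * (\<Sum>l\<in>J. T l) \<le> 1 / (U * N) * (N * T i)"
      using U N by (intro mult_left_mono) auto
    then have canc: "norm (\<Sum>l\<in>J. b l * exp (of_real (e l) * w + of_real (\<kappa> * l))) \<le> 1 / U * T i"
      using small N by (simp add: T_def)
    have "\<exists>j\<in>J. j \<noteq> i \<and> T i \<le> 2 * N * T j"
    proof (rule ccontr)
      assume "\<not> ?thesis"
      then have less: "T l \<le> T i / (2 * N)" if "l \<in> J - {i}" for l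
        using that N by (force simp: field_simps not_le)
      have "T i = norm (b i * exp (of_real (e i) * w + of_real (\<kappa> * i)))" by (simp only: normT)
      also have "b i * exp (of_real (e i) * w + of_real (\<kappa> * i))
          = (\<Sum>l\<in>J. b l * exp (of_real (e l) * w + of_real (\<kappa> * l)))
            - (\<Sum>l\<in>J - {i}. b l * exp (of_real (e l) * w + of_real (\<kappa> * l)))"
        using J(1) i(1) by (simp add: sum.remove)
      also have "norm \<dots> \<le> 1 / U * T i + (\<Sum>l\<in>J - {i}. T i / (2 * N))"
        using canc less by (intro norm_triangle_le_diff add_mono sum_norm_le) (simp_all only: normT)
      also have "(\<Sum>l\<in>J - {i}. T i / (2 * N)) \<le> N * (T i / (2 * N))"
        unfolding sum_constant N_def using J i Tpos[OF i(1)]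
        by (intro mult_right_mono) (auto intro: card_mono)
      also have "1 / U * T i \<le> 1 / 3 * T i"
        using U Tpos[OF i(1)] by (intro mult_right_mono) (auto simp: field_simps)
      finally show False using Tpos[OF i(1)] N by simp
    qed
    then obtain j where "j \<in> J" "j \<noteq> i" "T i \<le> 2 * N * T j" by blast
    then show "\<exists>(s, \<sigma>)\<in>growth_pairs J b e. \<bar>exp (\<kappa> - \<sigma> * Re w) - s\<bar> \<le> \<epsilon> * s"
      using U(1)[of i j, unfolded P_def, rule_format, of w \<kappa>] i(1) w dom canc by (simp add: T_def N_def)
  qed
qed

section \<open>Monotone functions near exponential curves\<close>

definition curve :: "real \<times> real \<Rightarrow> real \<Rightarrow> real" where
  "curve p t = fst p * exp (snd p * t)"

text \<open>The curves are ordered lexicographically, by \<open>\<sigma>\<close> and then by \<open>s\<close>.\<close>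

lemma curve_compare:
  assumes "fst p > 0" "fst q > 0" "p \<noteq> q"
  shows "(\<exists>c<1. c > 0 \<and> eventually (\<lambda>t. curve p t \<le> c * curve q t) at_top) \<or>
         (\<exists>c<1. c > 0 \<and> eventually (\<lambda>t. curve q t \<le> c * curve p t) at_top)"
proof -
  have step: "\<exists>c<1. c > 0 \<and> eventually (\<lambda>t. curve p t \<le> c * curve q t) at_top"
    if p: "fst p > 0" and q: "fst q > 0" and less: "snd p < snd q \<or> snd p = snd q \<and> fst p < fst q"
    for p q
  proof (cases "snd p = snd q")
    case True
    then show ?thesis
      using p q less by (intro exI[of _ "fst p / fst q"]) (auto simp: curve_def)
  next
    case False
    define d where "d = snd q - snd p"
    have "d > 0" using False less by (auto simp: d_def)
    then have "eventually (\<lambda>t. fst p / (1/2 * fst q) \<le> exp (d * t)) at_top"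
    proof -
      have "filterlim (\<lambda>t. exp (d * t)) at_top at_top" using \<open>d > 0\<close> by real_asymp
      then show ?thesis by (simp add: filterlim_at_top)
    qed
    then have "eventually (\<lambda>t. curve p t \<le> 1/2 * curve q t) at_top"
    proof eventually_elim
      case (elim t)
      then have "fst p \<le> 1/2 * fst q * exp (d * t)" using q by (simp add: field_simps)
      then have "fst p * exp (snd p * t) \<le> 1/2 * fst q * exp (d * t) * exp (snd p * t)"
        by (intro mult_right_mono) auto
      then show ?case by (simp add: curve_def d_def exp_add[symmetric] algebra_simps)
    qed
    then show ?thesis by (intro exI[of _ "1/2"]) auto
  qed
  show ?thesis
    using step[of p q] step[of q p] assms by (metis linorder_neqE prod.expand)
qed


lemma curve_shift: "curve p (t + d) = exp (snd p * d) * curve p t"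
  by (simp add: curve_def distrib_left exp_add)

lemma uniform_positive_constant:
  assumes "finite A" "\<And>q. q \<in> A \<Longrightarrow> \<exists>c>0. P q (c::real)"
    and "\<And>q c c'. P q c \<Longrightarrow> 0 < c' \<Longrightarrow> c' \<le> c \<Longrightarrow> P q c'"
  shows "\<exists>c>0. \<forall>q\<in>A. P q c"
  using assms(1,2)
proof (induction A)
  case empty
  then show ?case by (auto intro: exI[of _ 1])
next
  case (insert x A)
  then obtain c where "c > 0" "\<forall>q\<in>A. P q c" by blast
  moreover obtain d where "d > 0" "P x d" using insert.prems by blast
  ultimately show ?case
    using assms(3) by (intro exI[of _ "min c d"]) auto
qed

lemma dominant_curve_exists:
  assumes "finite A" "A \<noteq> {}" "\<And>q. q \<in> A \<Longrightarrow> fst q > 0"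
  shows "\<exists>p\<in>A. \<forall>q\<in>A. eventually (\<lambda>t. curve q t \<le> curve p t) at_top"
  using assms
proof (induction A rule: finite_ne_induct)
  case (singleton x)
  then show ?case by simp
next
  case (insert x A)
  then obtain p where p: "p \<in> A" "\<And>q. q \<in> A \<Longrightarrow> eventually (\<lambda>t. curve q t \<le> curve p t) at_top"
    by (metis insertI2)
  have "eventually (\<lambda>t. curve x t \<le> curve p t) at_top \<or> eventually (\<lambda>t. curve p t \<le> curve x t) at_top"
  proof -
    have weaken: "eventually (\<lambda>t. curve q t \<le> curve r t) at_top"
      if "eventually (\<lambda>t. curve q t \<le> c * curve r t) at_top" "c < 1" "fst r > 0" for q r c
      using that(1)
    proof eventually_elim
      case (elim t)
      have "c * curve r t \<le> 1 * curve r t" using that by (intro mult_right_mono) (auto simp: curve_def)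
      with elim show ?case by simp
    qed
    have pos: "fst x > 0" "fst p > 0" and "x \<noteq> p" using insert p(1) by auto
    from curve_compare[OF this] weaken[OF _ _ pos(1)] weaken[OF _ _ pos(2)] show ?thesis by blast
  qed
  then show ?case
  proof
    assume "eventually (\<lambda>t. curve x t \<le> curve p t) at_top"
    then show ?thesis using p by (intro bexI[of _ p]) auto
  next
    assume px: "eventually (\<lambda>t. curve p t \<le> curve x t) at_top"
    have "eventually (\<lambda>t. curve q t \<le> curve x t) at_top" if "q \<in> A" for q
      using p(2)[OF that] px by eventually_elim simp
    then show ?thesis by (intro bexI[of _ x]) auto
  qed
qed

text \<open>A nondecreasing function that keeps returning to finitely many exponential curves follows one
  of them. The curves separate by constant factors, and between two consecutive returns a curve
  rises by a factor near one only, so \<open>K\<close> cannot come down from the highest curve that it reaches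
  infinitely often, and it stays below the curves that it reaches finitely often.\<close>

lemma mono_follows_one_curve:
  fixes K :: "real \<Rightarrow> real"
  assumes mono: "mono K" and S: "finite S" "\<And>p. p \<in> S \<Longrightarrow> fst p > 0"
    and near: "\<And>\<epsilon> h. \<epsilon> > 0 \<Longrightarrow> h > 0 \<Longrightarrow>
      eventually (\<lambda>t. \<exists>u\<in>{t..t + h}. \<exists>p\<in>S. \<bar>K u - curve p u\<bar> \<le> \<epsilon> * curve p u) at_top"
  shows "\<exists>p\<in>S. ((\<lambda>t. K t / curve p t) \<longlongrightarrow> 1) at_top"
proof -
  have pos: "curve p t > 0" if "p \<in> S" for p t
    using S(2)[OF that] by (simp add: curve_def)
  (* the curves that K reaches, or comes close to from below, arbitrarily late *)
  define A where "A = {p\<in>S. \<forall>\<epsilon>>0. \<exists>\<^sub>F u in at_top. (1 - \<epsilon>) * curve p u \<le> K u}"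
  have "\<exists>\<epsilon>>0. \<forall>q\<in>S - A. eventually (\<lambda>u. K u < (1 - \<epsilon>) * curve q u) at_top \<and> q \<in> S"
  proof (rule uniform_positive_constant)
    show "\<exists>\<epsilon>>0. eventually (\<lambda>u. K u < (1 - \<epsilon>) * curve q u) at_top \<and> q \<in> S" if "q \<in> S - A" for q
      using that by (auto simp: A_def frequently_def not_le)
    show "eventually (\<lambda>u. K u < (1 - \<epsilon>') * curve q u) at_top \<and> q \<in> S"
      if *: "eventually (\<lambda>u. K u < (1 - \<epsilon>) * curve q u) at_top \<and> q \<in> S" "\<epsilon>' \<le> \<epsilon>" for q \<epsilon> \<epsilon>'
    proof (intro conjI)
      show "eventually (\<lambda>u. K u < (1 - \<epsilon>') * curve q u) at_top"
        using conjunct1[OF *(1)]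
      proof eventually_elim
        case (elim u)
        have "(1 - \<epsilon>) * curve q u \<le> (1 - \<epsilon>') * curve q u"
          using *(2) pos[OF conjunct2[OF *(1)], of u] by (intro mult_right_mono) auto
        with elim show ?case by linarith
      qed
    qed (use * in auto)
  qed (use S in auto)
  then obtain \<epsilon>0 where \<epsilon>0: "\<epsilon>0 > 0" "\<forall>q\<in>S - A. eventually (\<lambda>u. K u < (1 - \<epsilon>0) * curve q u) at_top"
    by blast
  then have low: "eventually (\<lambda>u. \<forall>q\<in>S - A. K u < (1 - \<epsilon>0) * curve q u) at_top"
    using S(1) by (intro eventually_ball_finite) auto
  have nearA: "eventually (\<lambda>t. \<exists>u\<in>{t..t + h}. \<exists>p\<in>A. \<bar>K u - curve p u\<bar> \<le> \<epsilon> * curve p u) at_top"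
    if \<epsilon>: "0 < \<epsilon>" "\<epsilon> \<le> \<epsilon>0" and h: "h > 0" for \<epsilon> h
    using near[OF \<epsilon>(1) h] eventually_all_ge_at_top[OF low]
  proof eventually_elim
    case (elim t)
    then obtain u q where u: "u \<in> {t..t + h}" "q \<in> S" "\<bar>K u - curve q u\<bar> \<le> \<epsilon> * curve q u" by blast
    have "(1 - \<epsilon>0) * curve q u \<le> (1 - \<epsilon>) * curve q u"
      using \<epsilon> pos[OF u(2), of u] by (intro mult_right_mono) auto
    also have "\<dots> \<le> K u" using u(3) by (simp add: abs_le_iff algebra_simps)
    finally have "q \<in> A" using elim(2) u(1,2) by force
    with u show ?case by blast
  qed
  have "A \<noteq> {}"
    using eventually_happens'[OF trivial_limit_at_top_linorder nearA[OF \<epsilon>0(1) order_refl, of 1]] by auto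
  have finA: "finite A" using S(1) by (simp add: A_def)
  obtain p where p: "p \<in> A" "\<And>q. q \<in> A \<Longrightarrow> eventually (\<lambda>t. curve q t \<le> curve p t) at_top"
    using dominant_curve_exists[OF finA \<open>A \<noteq> {}\<close>] S(2) by (auto simp: A_def)
  have pS: "p \<in> S" using p(1) by (simp add: A_def)
  have "\<exists>c>0. \<forall>q\<in>A - {p}. eventually (\<lambda>t. curve q t \<le> (1 - c) * curve p t) at_top"
  proof (rule uniform_positive_constant)
    fix q assume q: "q \<in> A - {p}"
    then have qS: "q \<in> S" by (simp add: A_def)
    have "\<not> eventually (\<lambda>t. curve p t \<le> c * curve q t) at_top" if "c < 1" for c
    proof
      assume "eventually (\<lambda>t. curve p t \<le> c * curve q t) at_top"
      then have "eventually (\<lambda>t. False) (at_top :: real filter)"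
        using p(2)[OF DiffD1[OF q]]
      proof eventually_elim
        case (elim t)
        have "c * curve q t < 1 * curve q t" using that pos[OF qS] by (intro mult_strict_right_mono) auto
        with elim show ?case by simp
      qed
      then show False by simp
    qed
    then obtain c where "c < 1" "eventually (\<lambda>t. curve q t \<le> c * curve p t) at_top"
      using curve_compare[of q p] S(2)[OF pS] S(2)[OF qS] q by blast
    then show "\<exists>c>0. eventually (\<lambda>t. curve q t \<le> (1 - c) * curve p t) at_top"
      by (intro exI[of _ "1 - c"]) auto
  next
    fix q and c c' :: real
    assume *: "eventually (\<lambda>t. curve q t \<le> (1 - c) * curve p t) at_top" "c' \<le> c"
    from *(1) show "eventually (\<lambda>t. curve q t \<le> (1 - c') * curve p t) at_top"
    proof eventually_elim
      case (elim t)
      have "(1 - c) * curve p t \<le> (1 - c') * curve p t"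
        using *(2) pos[OF pS, of t] by (intro mult_right_mono) auto
      with elim show ?case by linarith
    qed
  qed (use finA in auto)
  then obtain c where c: "c > 0" "\<forall>q\<in>A - {p}. eventually (\<lambda>t. curve q t \<le> (1 - c) * curve p t) at_top"
    by blast
  then have gap: "eventually (\<lambda>t. \<forall>q\<in>A - {p}. curve q t \<le> (1 - c) * curve p t) at_top"
    using finA by (intro eventually_ball_finite) auto
  have top: "eventually (\<lambda>t. \<forall>q\<in>A. curve q t \<le> curve p t) at_top"
    using finA p(2) by (intro eventually_ball_finite) auto
  have squeeze: "eventually (\<lambda>t. (1 - \<epsilon>)\<^sup>2 \<le> K t / curve p t \<and> K t / curve p t \<le> (1 + \<epsilon>) / (1 - \<epsilon>)) at_top"
    if \<epsilon>: "0 < \<epsilon>" "\<epsilon> \<le> \<epsilon>0" "3 * \<epsilon> < c" "\<epsilon> < 1" for \<epsilon>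
  proof -
    (* so short that curve p varies by at most a factor 1 - \<epsilon> over a distance 2 * h *)
    define h where "h = \<epsilon> / (2 * \<bar>snd p\<bar> + 1)"
    have h: "h > 0" "2 * \<bar>snd p\<bar> * h \<le> \<epsilon>" using \<epsilon> by (auto simp: h_def field_simps)
    have rise: "(1 - \<epsilon>) * curve p t \<le> curve p t'" if "\<bar>t - t'\<bar> \<le> 2 * h" for t t'
    proof -
      have "\<bar>snd p * (t' - t)\<bar> \<le> \<bar>snd p\<bar> * (2 * h)"
        unfolding abs_mult using that by (intro mult_left_mono) auto
      then have "1 - \<epsilon> \<le> 1 + snd p * (t' - t)" using h by (simp add: abs_le_iff)
      also have "\<dots> \<le> exp (snd p * (t' - t))" by (rule exp_ge_add_one_self)
      finally have "(1 - \<epsilon>) * curve p t \<le> exp (snd p * (t' - t)) * curve p t"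
        using pos[OF pS, of t] by (intro mult_right_mono) auto
      then show ?thesis using curve_shift[of p t "t' - t"] by simp
    qed
    have upper: "eventually (\<lambda>t. K t / curve p t \<le> (1 + \<epsilon>) / (1 - \<epsilon>)) at_top"
      using nearA[OF \<epsilon>(1,2) h(1)] eventually_all_ge_at_top[OF top]
    proof eventually_elim
      case (elim t)
      then obtain u q where u: "u \<in> {t..t + h}" "q \<in> A" "\<bar>K u - curve q u\<bar> \<le> \<epsilon> * curve q u" by blast
      have "K t \<le> K u" using u(1) by (intro monoD[OF mono]) auto
      also have "\<dots> \<le> (1 + \<epsilon>) * curve q u" using u(3) by (simp add: abs_le_iff algebra_simps)
      also have "\<dots> \<le> (1 + \<epsilon>) * curve p u" using elim(2) u \<epsilon> by (intro mult_left_mono) auto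
      also have "\<dots> \<le> (1 + \<epsilon>) * (curve p t / (1 - \<epsilon>))"
        using rise[of u t] u(1) \<epsilon> h by (intro mult_left_mono) (auto simp: field_simps)
      finally show ?case using pos[OF pS, of t] by (simp add: field_simps)
    qed
    have "eventually (\<lambda>t. (\<exists>u\<in>{t..t + h}. \<exists>p\<in>A. \<bar>K u - curve p u\<bar> \<le> \<epsilon> * curve p u) \<and>
        (\<forall>q\<in>A - {p}. curve q t \<le> (1 - c) * curve p t)) at_top"
      using nearA[OF \<epsilon>(1,2) h(1)] gap by (rule eventually_conj)
    then obtain T0 where T0:
      "\<And>t. t \<ge> T0 \<Longrightarrow> \<exists>u\<in>{t..t + h}. \<exists>p\<in>A. \<bar>K u - curve p u\<bar> \<le> \<epsilon> * curve p u"
      "\<And>t q. t \<ge> T0 \<Longrightarrow> q \<in> A \<Longrightarrow> q \<noteq> p \<Longrightarrow> curve q t \<le> (1 - c) * curve p t"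
      unfolding eventually_at_top_linorder by blast
    define good where "good = (\<lambda>t. t \<ge> T0 \<and> (1 - \<epsilon>) * curve p t \<le> K t)"
    (* K has risen too high for the curves below p, so at its next return it is near p again *)
    have next_good: "\<exists>u\<in>{t + h..t + 2 * h}. good u" if t: "good t" for t
    proof -
      obtain u q where u: "u \<in> {t + h..t + h + h}" "q \<in> A" "\<bar>K u - curve q u\<bar> \<le> \<epsilon> * curve q u"
        using T0(1)[of "t + h"] t h by (auto simp: good_def)
      have uT: "u \<ge> T0" using u(1) t h by (auto simp: good_def)
      have "(1 - \<epsilon>) * ((1 - \<epsilon>) * curve p u) \<le> (1 - \<epsilon>) * curve p t"
        using rise[of u t] u(1) h \<epsilon> by (intro mult_left_mono) auto
      also have "\<dots> \<le> K t" using t by (simp add: good_def)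
      also have "\<dots> \<le> K u" using u(1) h by (intro monoD[OF mono]) auto
      finally have lower: "(1 - \<epsilon>)\<^sup>2 * curve p u \<le> K u" by (simp add: power2_eq_square mult.assoc)
      have "q = p"
      proof (rule ccontr)
        assume "q \<noteq> p"
        have "K u \<le> (1 + \<epsilon>) * curve q u" using u(3) by (simp add: abs_le_iff algebra_simps)
        also have "\<dots> \<le> (1 + \<epsilon>) * ((1 - c) * curve p u)"
          using T0(2)[OF uT u(2) \<open>q \<noteq> p\<close>] \<epsilon> by (intro mult_left_mono) auto
        finally have "(1 - \<epsilon>)\<^sup>2 * curve p u \<le> ((1 + \<epsilon>) * (1 - c)) * curve p u"
          using lower by (simp add: mult.assoc)
        then have "(1 - \<epsilon>)\<^sup>2 \<le> (1 + \<epsilon>) * (1 - c)"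
          using pos[OF pS, of u] by (simp add: mult_le_cancel_right)
        then have "\<epsilon>\<^sup>2 + c + \<epsilon> * c \<le> 3 * \<epsilon>" by (simp add: power2_eq_square algebra_simps)
        moreover have "0 < \<epsilon>\<^sup>2" "0 < \<epsilon> * c" using \<epsilon> c(1) by auto
        ultimately show False using \<epsilon>(3) by linarith
      qed
      then have "(1 - \<epsilon>) * curve p u \<le> K u" using u(3) by (simp add: abs_le_iff algebra_simps)
      then show ?thesis using u(1) uT by (intro bexI[of _ u]) (auto simp: good_def)
    qed
    have "\<exists>\<^sub>F u in at_top. (1 - \<epsilon>) * curve p u \<le> K u"
      using p(1) \<epsilon>(1) by (simp add: A_def)
    from frequently_ex[OF frequently_eventually_frequently[OF this eventually_ge_at_top[of T0]]]
    obtain T where T: "good T" by (auto simp: good_def)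
    have recent: "\<exists>u\<le>t. t \<le> u + 2 * h \<and> good u" if "T \<le> t" "t \<le> T + real m * h" for t m
      using that
    proof (induction m arbitrary: t)
      case 0
      then show ?case using T h by (intro exI[of _ T]) auto
    next
      case (Suc m)
      show ?case
      proof (cases "T \<le> t - h")
        case False
        then show ?thesis using T h Suc.prems by (intro exI[of _ T]) auto
      next
        case True
        then obtain v where v: "v \<le> t - h" "t - h \<le> v + 2 * h" "good v"
          using Suc.IH[of "t - h"] Suc.prems by (auto simp: algebra_simps)
        obtain u where "u \<in> {v + h..v + 2 * h}" "good u" using next_good[OF v(3)] by blast
        then show ?thesis
          using v h by (cases "t \<le> v + 2 * h") (auto intro: exI[of _ v] exI[of _ u])
      qed
    qed
    have "eventually (\<lambda>t. (1 - \<epsilon>)\<^sup>2 \<le> K t / curve p t) at_top"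
      using eventually_ge_at_top[of T]
    proof eventually_elim
      case (elim t)
      obtain m where "(t - T) / h \<le> real m" using real_arch_simple by blast
      then have "t \<le> T + real m * h" using h by (simp add: field_simps)
      then obtain u where u: "u \<le> t" "t \<le> u + 2 * h" "good u" using recent[OF elim] by blast
      have "(1 - \<epsilon>) * ((1 - \<epsilon>) * curve p t) \<le> (1 - \<epsilon>) * curve p u"
        using rise[of t u] u \<epsilon> by (intro mult_left_mono) auto
      also have "\<dots> \<le> K u" using u(3) by (simp add: good_def)
      also have "\<dots> \<le> K t" using u(1) by (rule monoD[OF mono])
      finally show ?case using pos[OF pS, of t] by (simp add: field_simps power2_eq_square)
    qed
    with upper show ?thesis by eventually_elim simp
  qed
  have small: "eventually (\<lambda>\<epsilon>. 0 < \<epsilon> \<and> \<epsilon> \<le> \<epsilon>0 \<and> 3 * \<epsilon> < c \<and> \<epsilon> < 1) (at_right (0::real))"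
    using eventually_at_right_less[of 0] eventually_at_right_real[of 0 "min (min \<epsilon>0 (c / 3)) 1"] \<epsilon>0(1) c(1)
    by (auto elim!: eventually_mono)
  have "((\<lambda>t. K t / curve p t) \<longlongrightarrow> 1) at_top"
  proof (rule order_tendstoI)
    fix y :: real assume "y < 1"
    have "((\<lambda>\<epsilon>. (1 - \<epsilon>)\<^sup>2) \<longlongrightarrow> (1::real)) (at_right 0)" by (auto intro!: tendsto_eq_intros)
    then have "eventually (\<lambda>\<epsilon>. y < (1 - \<epsilon>)\<^sup>2) (at_right 0)" using \<open>y < 1\<close> by (rule order_tendstoD)
    from eventually_happens'[OF _ eventually_conj[OF this small]]
    obtain \<epsilon> where "y < (1 - \<epsilon>)\<^sup>2" "0 < \<epsilon>" "\<epsilon> \<le> \<epsilon>0" "3 * \<epsilon> < c" "\<epsilon> < 1" by auto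
    then show "eventually (\<lambda>t. y < K t / curve p t) at_top"
      using squeeze[of \<epsilon>] by (auto elim!: eventually_mono)
  next
    fix y :: real assume "y > 1"
    have "((\<lambda>\<epsilon>. (1 + \<epsilon>) / (1 - \<epsilon>)) \<longlongrightarrow> (1::real)) (at_right 0)" by (auto intro!: tendsto_eq_intros)
    then have "eventually (\<lambda>\<epsilon>. (1 + \<epsilon>) / (1 - \<epsilon>) < y) (at_right 0)" using \<open>y > 1\<close> by (rule order_tendstoD)
    from eventually_happens'[OF _ eventually_conj[OF this small]]
    obtain \<epsilon> where "(1 + \<epsilon>) / (1 - \<epsilon>) < y" "0 < \<epsilon>" "\<epsilon> \<le> \<epsilon>0" "3 * \<epsilon> < c" "\<epsilon> < 1" by auto
    then show "eventually (\<lambda>t. K t / curve p t < y) at_top"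
      using squeeze[of \<epsilon>] by (auto elim!: eventually_mono)
  qed
  with pS show ?thesis by blast
qed

section \<open>From the slope to the maximum modulus\<close>

text \<open>Integration of \<open>K \<le> k\<close> without differentiating: on a subdivision of \<open>[a, b]\<close> the errors telescope.\<close>

lemma increment_le_of_slope_le:
  fixes \<Phi> \<Psi> K k :: "real \<Rightarrow> real"
  assumes \<Phi>: "\<And>x y. \<Phi> y - \<Phi> x \<le> K y * (y - x)" and \<Psi>: "\<And>x y. k x * (y - x) \<le> \<Psi> y - \<Psi> x"
    and le: "\<And>t. a \<le> t \<Longrightarrow> K t \<le> k t" and ab: "a \<le> b"
  shows "\<Phi> b - \<Phi> a \<le> \<Psi> b - \<Psi> a"
proof -
  have sum: "\<Phi> (a + real i * d) - \<Phi> a \<le> \<Psi> (a + real i * d) - \<Psi> a + (k (a + real i * d) - k a) * d"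
    if d: "d \<ge> 0" for d i
  proof (induction i)
    case 0
    then show ?case by simp
  next
    case (Suc i)
    define x y where "x = a + real i * d" and "y = a + real (Suc i) * d"
    have xy: "y - x = d" by (simp add: x_def y_def algebra_simps)
    have "K y * d \<le> k y * d" using d by (intro mult_right_mono le) (simp_all add: y_def)
    then show ?case
      using Suc \<Phi>[of y x] \<Psi>[of x y] unfolding xy x_def[symmetric] y_def[symmetric] by (simp add: algebra_simps)
  qed
  have "\<Phi> b - \<Phi> a \<le> \<Psi> b - \<Psi> a + (k b - k a) * ((b - a) / real (Suc m))" for m
    using sum[of "(b - a) / real (Suc m)" "Suc m"] ab by simp
  moreover have "(\<lambda>m. \<Psi> b - \<Psi> a + (k b - k a) * ((b - a) / real (Suc m))) \<longlonglongrightarrow> \<Psi> b - \<Psi> a + (k b - k a) * 0"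
    by (intro tendsto_intros LIMSEQ_Suc lim_const_over_n)
  ultimately show ?thesis
    by (intro LIMSEQ_le_const) (auto intro!: exI[of _ 0])
qed

lemma exp_slope:
  fixes c \<sigma> :: real
  assumes "c \<ge> 0"
  shows "c * \<sigma> * exp (\<sigma> * x) * (y - x) \<le> c * exp (\<sigma> * y) - c * exp (\<sigma> * x)"
proof -
  have "c * exp (\<sigma> * x) * (\<sigma> * (y - x)) \<le> c * exp (\<sigma> * x) * (exp (\<sigma> * (y - x)) - 1)"
  proof (rule mult_left_mono)
    show "\<sigma> * (y - x) \<le> exp (\<sigma> * (y - x)) - 1"
      using exp_ge_add_one_self[of "\<sigma> * (y - x)"] by linarith
  qed (use assms in simp)
  also have "\<dots> = c * exp (\<sigma> * y) - c * exp (\<sigma> * x)"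
    by (simp add: algebra_simps exp_add[symmetric])
  finally show ?thesis by (simp add: mult_ac)
qed

lemma potential_asymptotics:
  fixes \<Phi> K :: "real \<Rightarrow> real"
  assumes sub: "\<And>x y. K x * (y - x) \<le> \<Phi> y - \<Phi> x" and s: "s > 0" and \<sigma>: "\<sigma> > 0"
    and lim: "((\<lambda>t. K t / curve (s, \<sigma>) t) \<longlongrightarrow> 1) at_top"
  shows "((\<lambda>t. \<Phi> t / (s / \<sigma> * exp (\<sigma> * t))) \<longlongrightarrow> 1) at_top"
proof -
  define E where "E = (\<lambda>t. s / \<sigma> * exp (\<sigma> * t))"
  have E: "E t > 0" for t using s \<sigma> by (simp add: E_def)
  have Einf: "filterlim E at_top at_top" unfolding E_def using s \<sigma> by real_asymp
  have slope: "c * curve (s, \<sigma>) x * (y - x) \<le> c * E y - c * E x" if "c \<ge> 0" for c x y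
    using exp_slope[of "c * s / \<sigma>" \<sigma> x y] that s \<sigma> by (simp add: E_def curve_def mult_ac)
  have sub': "\<Phi> y - \<Phi> x \<le> K y * (y - x)" for x y using sub[of y x] by (simp add: algebra_simps)
  have slope': "c * E y - c * E x \<le> c * curve (s, \<sigma>) y * (y - x)" if "c \<ge> 0" for c x y
    using slope[OF that, of y x] by (simp add: algebra_simps)
  have tail: "((\<lambda>t. c + d / E t) \<longlongrightarrow> c) at_top" for c d
    using tendsto_add[OF tendsto_const real_tendsto_divide_at_top[OF tendsto_const Einf]] by fastforce
  have "((\<lambda>t. \<Phi> t / E t) \<longlongrightarrow> 1) at_top"
  proof (rule order_tendstoI)
    fix y :: real assume "y > 1"
    then obtain c where c: "1 < c" "c < y" using dense by blast
    have "eventually (\<lambda>t. K t / curve (s, \<sigma>) t < c) at_top"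
      using order_tendstoD(2)[OF lim c(1)] .
    then obtain T where "\<And>t. t \<ge> T \<Longrightarrow> K t / curve (s, \<sigma>) t < c"
      unfolding eventually_at_top_linorder by blast
    then have T: "K t \<le> c * curve (s, \<sigma>) t" if "t \<ge> T" for t
      using that s by (force simp: curve_def field_simps intro: less_imp_le)
    have "eventually (\<lambda>t. c + (\<Phi> T - c * E T) / E t < y) at_top"
      using tail c(2) by (rule order_tendstoD(2))
    then show "eventually (\<lambda>t. \<Phi> t / E t < y) at_top"
      using eventually_ge_at_top[of T]
    proof eventually_elim
      case (elim t)
      have "\<Phi> t - \<Phi> T \<le> c * E t - c * E T"
        using c by (intro increment_le_of_slope_le[of \<Phi> K "\<lambda>t. c * curve (s, \<sigma>) t"] sub' slope T elim) auto
      then have "\<Phi> t / E t \<le> c + (\<Phi> T - c * E T) / E t" using E[of t] by (simp add: field_simps)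
      with elim show ?case by linarith
    qed
  next
    fix y :: real assume "y < 1"
    then obtain c where c: "max y 0 < c" "c < 1" using dense[of "max y 0" 1] by auto
    have "eventually (\<lambda>t. c < K t / curve (s, \<sigma>) t) at_top"
      using order_tendstoD(1)[OF lim c(2)] .
    then obtain T where "\<And>t. t \<ge> T \<Longrightarrow> c < K t / curve (s, \<sigma>) t"
      unfolding eventually_at_top_linorder by blast
    then have T: "c * curve (s, \<sigma>) t \<le> K t" if "t \<ge> T" for t
      using that s by (force simp: curve_def field_simps intro: less_imp_le)
    have "eventually (\<lambda>t. y < c + (\<Phi> T - c * E T) / E t) at_top"
      using tail c(1) by (intro order_tendstoD(1)) auto
    then show "eventually (\<lambda>t. y < \<Phi> t / E t) at_top"
      using eventually_ge_at_top[of T]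
    proof eventually_elim
      case (elim t)
      have "c * E t - c * E T \<le> \<Phi> t - \<Phi> T"
        using c by (intro increment_le_of_slope_le[of "\<lambda>t. c * E t" "\<lambda>t. c * curve (s, \<sigma>) t" K] sub slope' T elim) auto
      then have "(c * E t + (\<Phi> T - c * E T)) / E t \<le> \<Phi> t / E t"
        using E[of t] by (intro divide_right_mono) auto
      then have "c + (\<Phi> T - c * E T) / E t \<le> \<Phi> t / E t"
        using E[of t] by (simp add: add_divide_distrib)
      with elim show ?case by linarith
    qed
  qed
  then show ?thesis by (simp add: E_def)
qed

lemma growth_order_eq:
  assumes L: "L > 0"
    and lim: "((\<lambda>t. ln (max_modulus (exp t) f) / (L * exp (\<sigma> * t))) \<longlongrightarrow> 1) at_top"
  shows "growth_order f = ereal \<sigma>"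
proof -
  define \<Phi> where "\<Phi> = (\<lambda>t. ln (max_modulus (exp t) f))"
  define q where "q = (\<lambda>t. \<Phi> t / (L * exp (\<sigma> * t)))"
  have q: "(q \<longlongrightarrow> 1) at_top" using lim by (simp add: q_def \<Phi>_def)
  have "((\<lambda>t. (ln (q t) + ln L) / t) \<longlongrightarrow> 0) at_top"
    by (intro real_tendsto_divide_at_top[of _ "ln 1 + ln L"] tendsto_intros q filterlim_ident) auto
  then have "((\<lambda>t. (ln (q t) + ln L) / t + \<sigma>) \<longlongrightarrow> 0 + \<sigma>) at_top" by (intro tendsto_intros)
  moreover have "eventually (\<lambda>t. (ln (q t) + ln L) / t + \<sigma> = ln (\<Phi> t) / t) at_top"
    using order_tendstoD(1)[OF q, of 0, simplified] eventually_gt_at_top[of 0]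
  proof eventually_elim
    case (elim t)
    have "\<Phi> t = q t * (L * exp (\<sigma> * t))" using L by (simp add: q_def)
    then have "ln (\<Phi> t) = ln (q t) + ln L + \<sigma> * t" using elim L by (simp add: ln_mult)
    with elim show ?case by (simp add: field_simps)
  qed
  ultimately have "((\<lambda>t. ln (\<Phi> t) / t) \<longlongrightarrow> \<sigma>) at_top"
    by (simp add: tendsto_cong)
  then have "((\<lambda>r. ln (\<Phi> (ln r)) / ln r) \<longlongrightarrow> \<sigma>) at_top"
    by (rule filterlim_compose[OF _ ln_at_top])
  moreover have "eventually (\<lambda>r. ln (\<Phi> (ln r)) / ln r = ln (ln (max_modulus r f)) / ln r) at_top"
    using eventually_gt_at_top[of 0] by eventually_elim (simp add: \<Phi>_def)
  ultimately have "((\<lambda>r. ln (ln (max_modulus r f)) / ln r) \<longlongrightarrow> \<sigma>) at_top"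
    by (simp add: tendsto_cong)
  then show ?thesis
    unfolding growth_order_def by (intro lim_imp_Limsup) (auto intro: tendsto_ereal)
qed

lemma asymp_equiv_ln_max_modulus:
  assumes "((\<lambda>t. ln (max_modulus (exp t) f) / (L * exp (\<sigma> * t))) \<longlongrightarrow> 1) at_top"
  shows "(\<lambda>r. ln (max_modulus r f)) \<sim>[at_top] (\<lambda>r. L * r powr \<sigma>)"
proof (rule asymp_equivI')
  have "((\<lambda>r. ln (max_modulus (exp (ln r)) f) / (L * exp (\<sigma> * ln r))) \<longlongrightarrow> 1) at_top"
    using assms by (rule filterlim_compose[OF _ ln_at_top])
  moreover have "eventually (\<lambda>r. ln (max_modulus (exp (ln r)) f) / (L * exp (\<sigma> * ln r))
      = ln (max_modulus r f) / (L * r powr \<sigma>)) at_top"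
    using eventually_gt_at_top[of 0] by eventually_elim (simp add: powr_def)
  ultimately show "((\<lambda>r. ln (max_modulus r f) / (L * r powr \<sigma>)) \<longlongrightarrow> 1) at_top"
    by (simp add: tendsto_cong)
qed

section \<open>Edges of the Newton-Puiseux diagram\<close>

text \<open>The line of slope \<open>- \<sigma>\<close> through the two points supports the polygon from above. It cuts out a
  face that is spanned by diagram points, hence the segment between the first and the last of the
  points on the line.\<close>

lemma newton_puiseux_gradientI:
  assumes i: "i \<le> n" "a i \<noteq> 0" and j: "j \<le> n" "a j \<noteq> 0" and ij: "i \<noteq> j"
    and max: "\<And>l. l \<le> n \<Longrightarrow> a l \<noteq> 0 \<Longrightarrow> real (degree (a l)) - real l + \<sigma> * real l \<le> m"
    and attained: "real (degree (a i)) - real i + \<sigma> * real i = m" "real (degree (a j)) - real j + \<sigma> * real j = m"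
  shows "newton_puiseux_gradient n a (- \<sigma>)"
proof -
  define P where "P = newton_puiseux_points n a"
  define X where "X = {l. l \<le> n \<and> a l \<noteq> 0 \<and> real (degree (a l)) - real l + \<sigma> * real l = m}"
  define pt where "pt = (\<lambda>l::nat. (real l, m - \<sigma> * real l))"
  have fin: "finite P"
    unfolding P_def newton_puiseux_points_def by (rule finite_subset[of _ "(\<lambda>j. (real j, real (degree (a j)) - real j)) ` {..n}"]) auto
  have ptP: "pt l \<in> P" if "l \<in> X" for l
    using that by (force simp: P_def newton_puiseux_points_def X_def pt_def)
  have X: "finite X" "i \<in> X" "j \<in> X" using i j attained by (auto simp: X_def)
  define p q where "p = pt (Min X)" and "q = pt (Max X)"
  have "Min X \<in> X" "Max X \<in> X" using X by (auto intro!: Min_in Max_in)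
  have "Min X \<le> i" "i \<le> Max X" "Min X \<le> j" "j \<le> Max X" using X by auto
  with ij have "Min X < Max X" by linarith
  then have less: "fst p < fst q" by (simp add: p_def q_def pt_def)
  have below: "(\<sigma>, 1) \<bullet> x \<le> m" if "x \<in> convex hull P" for x
  proof -
    have "convex hull P \<subseteq> {x. (\<sigma>, 1) \<bullet> x \<le> m}"
      by (intro hull_minimal convex_halfspace_le)
         (use max in \<open>auto simp: P_def newton_puiseux_points_def inner_prod_def algebra_simps\<close>)
    with that show ?thesis by blast
  qed
  define F where "F = convex hull P \<inter> {x. (\<sigma>, 1) \<bullet> x = m}"
  have face: "F face_of convex hull P"
    unfolding F_def by (intro face_of_Int_supporting_hyperplane_le convex_convex_hull below)
  obtain P' where P': "P' \<subseteq> P" "F = convex hull P'"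
    using face_of_convex_hull_subset[OF finite_imp_compact[OF fin] face] by blast
  have seg: "closed_segment p q = F"
  proof
    have "p \<in> F" "q \<in> F"
      using ptP[OF \<open>Min X \<in> X\<close>] ptP[OF \<open>Max X \<in> X\<close>]
      by (auto simp: F_def p_def q_def hull_inc) (auto simp: pt_def inner_prod_def algebra_simps)
    then show "closed_segment p q \<subseteq> F"
      using face by (intro closed_segment_subset face_of_imp_convex[OF face]) auto
    have "x \<in> closed_segment p q" if x: "x \<in> P'" for x
    proof -
      have "x \<in> P" "(\<sigma>, 1) \<bullet> x = m"
        using x P'(1) hull_inc[OF x, of convex] unfolding P'(2)[symmetric] F_def by blast+
      then obtain l where "l \<le> n" "a l \<noteq> 0" "x = (real l, real (degree (a l)) - real l)"
        "real (degree (a l)) - real l + \<sigma> * real l = m"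
        by (auto simp: P_def newton_puiseux_points_def inner_prod_def)
      then have l: "l \<in> X" "x = pt l" by (auto simp: X_def pt_def)
      define u where "u = (real l - real (Min X)) / (real (Max X) - real (Min X))"
      have "Min X \<le> l" "l \<le> Max X" using X(1) l(1) by auto
      then have "0 \<le> u" "u \<le> 1" using \<open>Min X < Max X\<close> by (auto simp: u_def divide_simps)
      moreover have ul: "real l = (1 - u) * real (Min X) + u * real (Max X)"
      proof -
        have "u * (real (Max X) - real (Min X)) = real l - real (Min X)"
          using \<open>Min X < Max X\<close> by (simp add: u_def)
        then show ?thesis by (simp add: algebra_simps)
      qed
      have "x = (1 - u) *\<^sub>R p + u *\<^sub>R q"
        unfolding l(2) p_def q_def pt_def by (simp add: ul algebra_simps)
      ultimately show ?thesis unfolding closed_segment_def by blast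
    qed
    then show "F \<subseteq> closed_segment p q"
      unfolding P'(2) by (intro hull_minimal convex_closed_segment) auto
  qed
  have "aff_dim (closed_segment p q) = 1"
    using less by (auto simp: segment_convex_hull aff_dim_convex_hull aff_dim_2)
  then have "closed_segment p q edge_of convex hull P"
    using face by (simp add: edge_of_def seg)
  moreover have "closed_segment p q \<subseteq> newton_puiseux_diagram n a"
    unfolding seg using below
    by (force simp: F_def newton_puiseux_diagram_def P_def[symmetric] inner_prod_def)
  moreover have "- \<sigma> = (snd q - snd p) / (fst q - fst p)"
    using less by (simp add: p_def q_def pt_def field_simps)
  ultimately show ?thesis
    unfolding newton_puiseux_gradient_def P_def using less by blast
qed

section \<open>The growth of entire solutions\<close>

lemma poly_near_leading_term:
  fixes p :: "complex poly"
  assumes "p \<noteq> 0" "\<epsilon> > 0"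
  shows "eventually (\<lambda>z. norm (poly p z - lead_coeff p * z ^ degree p) \<le> \<epsilon> * norm (lead_coeff p * z ^ degree p))
    at_infinity"
proof -
  have "eventually (\<lambda>z. dist (poly p z / z ^ degree p) (lead_coeff p) < \<epsilon> * norm (lead_coeff p)) at_infinity"
    using assms by (intro tendstoD[OF poly_divide_tendsto_aux]) auto
  moreover have "eventually (\<lambda>z::complex. z \<noteq> 0) at_infinity"
    by (rule eventually_not_equal_at_infinity)
  ultimately show ?thesis
  proof eventually_elim
    case (elim z)
    have "poly p z - lead_coeff p * z ^ degree p = (poly p z / z ^ degree p - lead_coeff p) * z ^ degree p"
      using elim(2) by (simp add: algebra_simps)
    then show ?case
      using mult_right_mono[OF less_imp_le[OF elim(1)], of "norm (z ^ degree p)"]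
      by (simp add: dist_norm norm_mult mult.assoc)
  qed
qed

lemma relative_error_mult:
  fixes A A' D D' :: "'a::real_normed_field"
  assumes A: "norm (A - A') \<le> \<epsilon> * norm A'" and D: "norm (D - D') \<le> \<epsilon> * norm D'" and \<epsilon>: "0 \<le> \<epsilon>" "\<epsilon> \<le> 1"
  shows "norm (A' * D' - A * D) \<le> 3 * \<epsilon> * norm (A' * D')"
proof -
  have "norm D \<le> norm (D - D') + norm D'" using norm_triangle_ineq[of "D - D'" D'] by simp
  also have "\<dots> \<le> 2 * norm D'" using D \<epsilon> mult_right_mono[of \<epsilon> 1 "norm D'"] by simp
  finally have D2: "norm D \<le> 2 * norm D'" .
  have "A' * D' - A * D = - (A' * (D - D')) - (A - A') * D" by (simp add: algebra_simps)
  then have "norm (A' * D' - A * D) \<le> norm A' * norm (D - D') + norm (A - A') * norm D"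
    using norm_triangle_ineq4[of "- (A' * (D - D'))" "(A - A') * D"] by (simp add: norm_mult)
  also have "\<dots> \<le> norm A' * (\<epsilon> * norm D') + \<epsilon> * norm A' * (2 * norm D')"
    using A D D2 \<epsilon> by (intro add_mono mult_mono) auto
  also have "\<dots> = 3 * \<epsilon> * norm (A' * D')" by (simp add: norm_mult)
  finally show ?thesis .
qed

text \<open>The equation, divided by \<open>f z\<close> at a point of maximum modulus over a steady \<open>u\<close>, is a near
  cancellation: replacing \<open>a j\<close> by its leading term and \<open>\<Delta>\<^sup>j f z / f z\<close> by \<open>(\<eta> * K u / z) ^ j\<close> changes
  each summand by a small relative error only. The summands take the form required by
  \<open>near_cancellation\<close> with \<open>w = Ln z\<close> and \<open>\<kappa> = ln (K u)\<close>.\<close>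

lemma solution_near_growth_pair:
  fixes \<eta> :: complex and n :: nat and a :: "nat \<Rightarrow> complex poly" and \<Phi> K :: "real \<Rightarrow> real"
  defines "J \<equiv> {j. j \<le> n \<and> a j \<noteq> 0}"
    and "b \<equiv> (\<lambda>j. lead_coeff (a j) * \<eta> ^ j)"
    and "e \<equiv> (\<lambda>j. real (degree (a j)) - real j)"
  assumes \<eta>: "\<eta> \<noteq> 0" and coeffs: "\<exists>j\<le>n. a j \<noteq> 0"
    and f: "f holomorphic_on UNIV"
    and equation: "\<forall>z. (\<Sum>j\<le>n. poly (a j) z * (fdiff \<eta> ^^ j) f z) = 0"
    and M: "\<And>t. max_modulus (exp t) f = exp (\<Phi> t)"
    and sub: "\<And>x y. K x * (y - x) \<le> \<Phi> y - \<Phi> x"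
    and K: "filterlim K at_top at_top" and small: "((\<lambda>t. K t / exp t) \<longlongrightarrow> 0) at_top"
    and \<epsilon>: "\<epsilon> > 0" and h: "h > 0"
  shows "eventually (\<lambda>t. \<exists>u\<in>{t..t + h}. \<exists>p\<in>growth_pairs J b e. \<bar>K u - curve p u\<bar> \<le> \<epsilon> * curve p u) at_top"
proof -
  have J: "finite J" "J \<noteq> {}" and b: "\<forall>j\<in>J. b j \<noteq> 0"
    using coeffs \<eta> by (auto simp: J_def b_def)
  obtain \<delta> U where \<delta>: "\<delta> > 0" and cancel: "\<forall>w (\<kappa>::real). U \<le> Re w \<longrightarrow>
    norm (\<Sum>l\<in>J. b l * exp (of_real (e l) * w + of_real (\<kappa> * l)))
      \<le> \<delta> * (\<Sum>l\<in>J. norm (b l) * exp (e l * Re w + \<kappa> * l)) \<longrightarrow>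
    (\<exists>(s, \<sigma>)\<in>growth_pairs J b e. \<bar>exp (\<kappa> - \<sigma> * Re w) - s\<bar> \<le> \<epsilon> * s)"
    using near_cancellation[OF J b \<epsilon>, where e = e] by (elim exE conjE)
  define \<epsilon>' where "\<epsilon>' = min 1 (\<delta> / 3)"
  have \<epsilon>': "\<epsilon>' > 0" "\<epsilon>' \<le> 1" "3 * \<epsilon>' \<le> \<delta>" using \<delta> by (auto simp: \<epsilon>'_def)
  obtain \<gamma> where \<gamma>: "\<gamma> > 0" and wv: "eventually (\<lambda>u. steady K \<gamma> u \<longrightarrow>
    (\<forall>k\<le>n. \<forall>z. norm z = exp u \<longrightarrow> norm (f z) = exp (\<Phi> u) \<longrightarrow>
      norm ((fdiff \<eta> ^^ k) f z / f z - (\<eta> * of_real (K u) / z) ^ k) \<le> \<epsilon>' * (norm \<eta> * K u / exp u) ^ k)) at_top"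
    using wiman_valiron_differences[OF f M sub K small \<epsilon>'(1)] by blast
  have "eventually (\<lambda>z. \<forall>j\<in>J. norm (poly (a j) z - lead_coeff (a j) * z ^ degree (a j))
      \<le> \<epsilon>' * norm (lead_coeff (a j) * z ^ degree (a j))) at_infinity"
    using \<epsilon>' J(1) by (intro eventually_ball_finite ballI poly_near_leading_term) (auto simp: J_def)
  then obtain R where R: "\<And>z j. R \<le> norm z \<Longrightarrow> j \<in> J \<Longrightarrow>
      norm (poly (a j) z - lead_coeff (a j) * z ^ degree (a j)) \<le> \<epsilon>' * norm (lead_coeff (a j) * z ^ degree (a j))"
    unfolding eventually_at_infinity by blast
  have "eventually (\<lambda>u. exp u \<ge> R) at_top"
    using exp_at_top unfolding filterlim_at_top by blast
  moreover have "eventually (\<lambda>u. K u > 0) at_top"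
    using K unfolding filterlim_at_top_dense by blast
  ultimately have "eventually (\<lambda>u. steady K \<gamma> u \<longrightarrow>
      (\<exists>p\<in>growth_pairs J b e. \<bar>K u - curve p u\<bar> \<le> \<epsilon> * curve p u)) at_top"
    using wv eventually_ge_at_top[of U]
  proof eventually_elim
    case (elim u)
    show ?case
    proof
      assume st: "steady K \<gamma> u"
      obtain z where z: "norm z = exp u" "norm (f z) = exp (\<Phi> u)"
        using max_modulus_attained[OF f, of "exp u"] M by auto
      then have nz: "z \<noteq> 0" "f z \<noteq> 0" by auto
      define w where "w = Ln z"
      have w: "Re w = u" "exp w = z" using z nz by (simp_all add: w_def)
      define x where "x = \<eta> * of_real (K u) / z"
      define D where "D = (\<lambda>k. (fdiff \<eta> ^^ k) f z / f z)"
      define T where "T = (\<lambda>l. lead_coeff (a l) * z ^ degree (a l) * x ^ l)"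
      have T: "b l * exp (of_real (e l) * w + of_real (ln (K u) * l)) = T l" for l
      proof -
        have "of_real (e l) * w + of_real (ln (K u) * l)
            = of_nat (degree (a l)) * w + of_nat l * of_real (ln (K u)) - of_nat l * w"
          by (simp add: e_def algebra_simps)
        then have "exp (of_real (e l) * w + of_real (ln (K u) * l)) = z ^ degree (a l) * of_real (K u) ^ l / z ^ l"
          using elim(2) by (simp only: exp_diff exp_add exp_of_nat_mult w exp_of_real exp_ln)
        then show ?thesis by (simp add: b_def T_def x_def power_divide power_mult_distrib)
      qed
      have normT: "norm (b l) * exp (e l * Re w + ln (K u) * l) = norm (T l)" for l
        by (simp add: T[symmetric] norm_mult)
      have "(\<Sum>j\<in>J. poly (a j) z * D j) = (\<Sum>j\<le>n. poly (a j) z * (fdiff \<eta> ^^ j) f z) / f z"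
        unfolding sum_divide_distrib by (rule sum.mono_neutral_cong_left) (auto simp: J_def D_def)
      then have zero: "(\<Sum>j\<in>J. poly (a j) z * D j) = 0" using equation by simp
      have "norm (T l - poly (a l) z * D l) \<le> \<delta> * norm (T l)" if l: "l \<in> J" for l
      proof -
        have "norm (D l - x ^ l) \<le> \<epsilon>' * norm (x ^ l)"
          using elim(2,3) st l z
          by (simp add: D_def x_def J_def norm_power norm_divide norm_mult)
        then have "norm (T l - poly (a l) z * D l) \<le> 3 * \<epsilon>' * norm (T l)"
          unfolding T_def using R[of z l] z elim(1) l \<epsilon>' by (intro relative_error_mult) auto
        also have "\<dots> \<le> \<delta> * norm (T l)" using \<epsilon>' by (intro mult_right_mono) auto
        finally show ?thesis .
      qed
      then have "norm (\<Sum>l\<in>J. T l - poly (a l) z * D l) \<le> (\<Sum>l\<in>J. \<delta> * norm (T l))"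
        by (rule sum_norm_le)
      then have "norm (\<Sum>l\<in>J. T l) \<le> \<delta> * (\<Sum>l\<in>J. norm (T l))"
        by (simp add: sum_subtractf zero sum_distrib_left)
      then obtain s \<sigma> where s: "(s, \<sigma>) \<in> growth_pairs J b e" "\<bar>exp (ln (K u) - \<sigma> * u) - s\<bar> \<le> \<epsilon> * s"
        using cancel[rule_format, of w "ln (K u)"] elim(4) unfolding w(1) T normT[unfolded w(1)] by blast
      have "K u = exp (ln (K u) - \<sigma> * u) * exp (\<sigma> * u)"
        using elim(2) by (simp add: exp_add[symmetric])
      then have "K u - curve (s, \<sigma>) u = (exp (ln (K u) - \<sigma> * u) - s) * exp (\<sigma> * u)"
        by (simp add: curve_def left_diff_distrib)
      then have "\<bar>K u - curve (s, \<sigma>) u\<bar> \<le> \<epsilon> * curve (s, \<sigma>) u"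
        using mult_right_mono[OF s(2), of "exp (\<sigma> * u)"] by (simp add: abs_mult curve_def)
      with s(1) show "\<exists>p\<in>growth_pairs J b e. \<bar>K u - curve p u\<bar> \<le> \<epsilon> * curve p u" by blast
    qed
  qed
  from eventually_all_ge_at_top[OF this] eventually_steady[OF subgradient_mono[OF sub] K \<gamma> h]
  show ?thesis
  proof eventually_elim
    case (elim t)
    then show ?case by (meson atLeastAtMost_iff)
  qed
qed

theorem theorem6p1:
  fixes \<eta> :: complex and n :: nat and a :: "nat \<Rightarrow> complex poly"
    and f :: "complex \<Rightarrow> complex" and \<sigma> :: real
  assumes "\<eta> \<noteq> 0"
    and "\<exists>j\<le>n. a j \<noteq> 0"
    and "transcendental_entire f"
    and "growth_order f = ereal \<sigma>"
    and "\<sigma> < 1"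
    and "\<forall>z. (\<Sum>j\<le>n. poly (a j) z * (fdiff \<eta> ^^ j) f z) = 0"
  shows "\<sigma> \<in> \<rat> \<and> newton_puiseux_gradient n a (- \<sigma>) \<and> \<sigma> > 0 \<and>
    (\<exists>L>0. (\<lambda>r. ln (max_modulus r f)) \<sim>[at_top] (\<lambda>r. L * r powr \<sigma>))"
proof -
  have f: "f holomorphic_on UNIV" using assms(3) by (simp add: transcendental_entire_def)
  obtain z0 where nz: "f z0 \<noteq> 0"
    using assms(3) unfolding transcendental_entire_def by (metis poly_0)
  define \<Phi> where "\<Phi> = (\<lambda>t. ln (max_modulus (exp t) f))"
  have M: "max_modulus (exp t) f = exp (\<Phi> t)" for t
    using max_modulus_pos[OF f nz, of "exp t"] by (simp add: \<Phi>_def)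
  obtain K where sub: "\<And>x y. K x * (y - x) \<le> \<Phi> y - \<Phi> x"
    using convex_subgradient_exists[OF convex_ln_max_modulus[OF f nz]] unfolding \<Phi>_def by blast
  have K: "filterlim K at_top at_top"
    by (rule subgradient_at_top[OF assms(3)]) (use sub in \<open>simp add: \<Phi>_def\<close>)
  have small: "((\<lambda>t. K t / exp t) \<longlongrightarrow> 0) at_top"
    by (rule subgradient_small[of f]) (use assms(4,5) sub K in \<open>simp_all add: \<Phi>_def\<close>)
  define J where "J = {j. j \<le> n \<and> a j \<noteq> 0}"
  define b where "b = (\<lambda>j. lead_coeff (a j) * \<eta> ^ j)"
  define e where "e = (\<lambda>j. real (degree (a j)) - real j)"
  have J: "finite J" "\<And>j. j \<in> J \<Longrightarrow> b j \<noteq> 0" using assms(1) by (auto simp: J_def b_def)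
  have "\<exists>p\<in>growth_pairs J b e. ((\<lambda>t. K t / curve p t) \<longlongrightarrow> 1) at_top"
  proof (rule mono_follows_one_curve[OF subgradient_mono[OF sub] finite_growth_pairs[OF J]])
    show "fst p > 0" if "p \<in> growth_pairs J b e" for p using that by (auto simp: growth_pairs_def)
  qed (use solution_near_growth_pair[OF assms(1,2) f assms(6) M sub K small] in \<open>auto simp: J_def b_def e_def\<close>)
  then obtain s \<tau> where p: "(s, \<tau>) \<in> growth_pairs J b e" "((\<lambda>t. K t / curve (s, \<tau>) t) \<longlongrightarrow> 1) at_top"
    by auto
  then obtain i j where ij: "i \<in> J" "j \<in> J" "i \<noteq> j" "\<tau> = tie_exponent e i j"
    "i \<in> tight J e \<tau>" "j \<in> tight J e \<tau>" and s: "s > 0"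
    by (auto simp: growth_pairs_def)
  have "\<tau> > 0"
  proof (rule ccontr)
    assume "\<not> \<tau> > 0"
    have "eventually (\<lambda>t. K t / curve (s, \<tau>) t < 2) at_top"
      using p(2) by (rule order_tendstoD) simp
    moreover have "eventually (\<lambda>t. K t > 2 * s) at_top"
      using K unfolding filterlim_at_top_dense by blast
    ultimately have "eventually (\<lambda>t::real. False) at_top"
      using eventually_ge_at_top[of 0]
    proof eventually_elim
      case (elim t)
      have "curve (s, \<tau>) t \<le> s * 1"
        unfolding curve_def using s elim(3) \<open>\<not> \<tau> > 0\<close> by (intro mult_mono) (auto simp: mult_nonpos_nonneg)
      moreover have "K t < 2 * curve (s, \<tau>) t"
        using elim(1) s by (simp add: curve_def field_simps)
      ultimately show False using elim(2) by simp
    qed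
    then show False by simp
  qed
  then have lim: "((\<lambda>t. ln (max_modulus (exp t) f) / (s / \<tau> * exp (\<tau> * t))) \<longlongrightarrow> 1) at_top"
    using potential_asymptotics[OF sub s _ p(2)] by (simp add: \<Phi>_def)
  have L: "s / \<tau> > 0" using s \<open>\<tau> > 0\<close> by simp
  have "\<tau> = \<sigma>" using growth_order_eq[OF L lim] assms(4) by simp
  moreover have "\<tau> \<in> \<rat>"
    unfolding ij(4) tie_exponent_def e_def by (intro Rats_divide Rats_diff Rats_of_nat)
  moreover have "newton_puiseux_gradient n a (- \<tau>)"
  proof (rule newton_puiseux_gradientI[of i n a j \<tau> "e i + \<tau> * real i"])
    show "real (degree (a j)) - real j + \<tau> * real j = e i + \<tau> * real i"
      using ij by (force simp: tight_def e_def intro: antisym)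
    show "real (degree (a l)) - real l + \<tau> * real l \<le> e i + \<tau> * real i" if "l \<le> n" "a l \<noteq> 0" for l
      using ij(5) that by (auto simp: tight_def J_def e_def)
  qed (use ij in \<open>auto simp: J_def e_def\<close>)
  ultimately show ?thesis
    using \<open>\<tau> > 0\<close> L asymp_equiv_ln_max_modulus[OF lim] by blast
qed

end
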